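(* There exist positive absolute constants $C, c$ such that the following holds. Let $m$, $n$ and $r < cm$ be positive integers such that $m = n + R$, where $R \ge C r \log(m/r)$. Then, with probability at least $1 - e^{-cR}$, a random $n$-dimensional subspace $Y$ of $\mathbb{R}^m$ has the following property: for every $y \in Y$ and every $y' \in \mathbb{R}^m$ that differs from $y$ in at most $r$ coordinates, $y$ is the unique solution of the minimization problem $$\min_{u \in Y} \|u - y'\|_1 .$$
   Context: Random $n$-dimensional subspaces of $\mathbb{R}^m$ are distributed according to the normalized Haar (rotation-invariant probability) measure on the Grassmannian $G_{m,n}$ of $n$-dimensional linear subspaces of $\mathbb{R}^m$. For $x \in \mathbb{R}^m$, $\|x\|_1 = \sum_{i=1}^m |x_i|$. Absolute constants do not depend on any parameter. *)

theory Defs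
  imports "HOL-Analysis.Finite_Function_Topology" "HOL-Probability.Probability"
begin

text \<open>
  The dimension has to vary inside the theorem, because its constants must not depend on it. So
  all the spaces \<open>\<real>\<^sup>m\<close> live in one ambient type: the points of \<open>\<real>\<^sup>m\<close> are the finitely supported
  real sequences vanishing outside the coordinates \<open>0, \<dots>, m - 1\<close>. This is a
  \<^class>\<open>real_vector\<close>, so the library's \<^const>\<open>subspace\<close>, \<^const>\<open>dim\<close> and \<^const>\<open>linear\<close> apply.
\<close>

type_synonym rseq = "nat \<Rightarrow>\<^sub>0 real"

definition rvec :: "nat \<Rightarrow> rseq set" where
  "rvec m = {x. Poly_Mapping.keys x \<subseteq> {..<m}}"

definition l1norm :: "nat \<Rightarrow> rseq \<Rightarrow> real" where
  "l1norm m x = (\<Sum>i<m. \<bar>Poly_Mapping.lookup x i\<bar>)"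

definition dotp :: "nat \<Rightarrow> rseq \<Rightarrow> rseq \<Rightarrow> real" where
  "dotp m x y = (\<Sum>i<m. Poly_Mapping.lookup x i * Poly_Mapping.lookup y i)"

definition l2norm :: "nat \<Rightarrow> rseq \<Rightarrow> real" where
  "l2norm m x = sqrt (dotp m x x)"

definition grassmannian :: "nat \<Rightarrow> nat \<Rightarrow> rseq set set" where
  "grassmannian m n = {Y. subspace Y \<and> Y \<subseteq> rvec m \<and> dim Y = n}"

definition orth_proj :: "nat \<Rightarrow> rseq set \<Rightarrow> rseq \<Rightarrow> rseq" where
  "orth_proj m Y x = (THE y. y \<in> Y \<and> (\<forall>z\<in>Y. dotp m (x - y) z = 0))"

text \<open>
  The Grassmannian carries its usual topology, induced by the metric that sends \<open>Y\<close> and \<open>Z\<close> to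
  the Euclidean operator norm of \<open>P\<^sub>Y - P\<^sub>Z\<close>. The \<open>max 0\<close> has no effect on the Grassmannian; it is there
  because \<^locale>\<open>Metric_space\<close> requires nonnegativity for arbitrary sets \<open>Y\<close>, \<open>Z\<close>, for which the supremum
  need not exist.
\<close>

definition gap :: "nat \<Rightarrow> rseq set \<Rightarrow> rseq set \<Rightarrow> real" where
  "gap m Y Z =
     max 0 (SUP x\<in>{x \<in> rvec m. l2norm m x \<le> 1}. l2norm m (orth_proj m Y x - orth_proj m Z x))"

definition grassmannian_borel :: "nat \<Rightarrow> nat \<Rightarrow> rseq set measure" where
  "grassmannian_borel m n =
     sigma (grassmannian m n) {A. openin (Metric_space.mtopology (grassmannian m n) (gap m)) A}"

text \<open>
  The orthogonal group of \<open>\<real>\<^sup>m\<close>. Only the restriction of \<open>U\<close> to \<open>\<real>\<^sup>m\<close> matters; every linear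
  isometry of \<open>\<real>\<^sup>m\<close> arises in this way, since it extends linearly to the ambient type.
\<close>

definition rotations :: "nat \<Rightarrow> (rseq \<Rightarrow> rseq) set" where
  "rotations m = {U. linear U \<and> U ` rvec m \<subseteq> rvec m \<and>
     (\<forall>x\<in>rvec m. \<forall>y\<in>rvec m. dotp m (U x) (U y) = dotp m x y)}"

text \<open>
  \<open>\<mu>\<close> is the normalized Haar measure on the Grassmannian, i.e. its (unique) rotation-invariant
  Borel probability measure.
\<close>

definition is_haar_grassmannian :: "nat \<Rightarrow> nat \<Rightarrow> rseq set measure \<Rightarrow> bool" where
  "is_haar_grassmannian m n \<mu> \<longleftrightarrow>
     prob_space \<mu> \<and> space \<mu> = grassmannian m n \<and> sets \<mu> = sets (grassmannian_borel m n) \<and>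
     (\<forall>U\<in>rotations m. distr \<mu> \<mu> ((`) U) = \<mu>)"


text \<open>Well-definedness of the orthogonal projections and of the metric.\<close>

lemma lookup_scaleR_poly [simp]:
  "Poly_Mapping.lookup (a *\<^sub>R x) i = a * Poly_Mapping.lookup (x :: rseq) i"
proof -
  have "finite {i. a *\<^sub>R Poly_Mapping.lookup x i \<noteq> 0}"
    by (rule finite_subset[of _ "Poly_Mapping.keys x"]) (auto simp: in_keys_iff)
  then show ?thesis
    by (simp add: scaleR_poly_mapping_def)
qed

lemma subspace_rvec: "subspace (rvec m)"
  unfolding rvec_def subspace_def 
  by (auto simp: in_keys_iff lookup_add subset_iff) (metis add.left_neutral)

lemma dotp_simps:
  "dotp m (x + y) z = dotp m x z + dotp m y z"
  "dotp m (x - y) z = dotp m x z - dotp m y z"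
  "dotp m x (y + z) = dotp m x y + dotp m x z"
  "dotp m x (y - z) = dotp m x y - dotp m x z"
  "dotp m (a *\<^sub>R x) z = a * dotp m x z"
  "dotp m x (a *\<^sub>R z) = a * dotp m x z"
  "dotp m 0 z = 0" "dotp m x 0 = 0"
  by (simp_all add: dotp_def lookup_add lookup_minus algebra_simps sum.distrib
      sum_subtractf sum_distrib_left)

lemma dotp_commute: "dotp m x y = dotp m y x"
  by (simp add: dotp_def mult.commute)

lemma dotp_nonneg: "dotp m x x \<ge> 0"
  by (simp add: dotp_def sum_nonneg)

lemma dotp_eq_0:
  assumes "x \<in> rvec m" "dotp m x x = 0"
  shows "x = 0"
proof (rule poly_mapping_eqI)
  fix i
  have *: "\<forall>i\<in>{..<m}. Poly_Mapping.lookup x i * Poly_Mapping.lookup x i = 0"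
    using assms(2) unfolding dotp_def
    by (subst (asm) sum_nonneg_eq_0_iff) auto
  show "Poly_Mapping.lookup x i = Poly_Mapping.lookup 0 i"
  proof (cases "i < m")
    case True
    then show ?thesis using * by auto
  next
    case False
    then have "i \<notin> Poly_Mapping.keys x" using assms(1) by (auto simp: rvec_def)
    then show ?thesis by (simp add: in_keys_iff)
  qed
qed

lemma l2norm_L2_set: "l2norm m x = L2_set (Poly_Mapping.lookup x) {..<m}"
  by (simp add: l2norm_def dotp_def L2_set_def power2_eq_square)

lemma l2norm_nonneg: "l2norm m x \<ge> 0"
  by (simp add: l2norm_def dotp_nonneg)

lemma l2norm_triangle: "l2norm m (x + y) \<le> l2norm m x + l2norm m y"
  using L2_set_triangle_ineq[of "Poly_Mapping.lookup x" "Poly_Mapping.lookup y" "{..<m}"]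
  by (simp add: l2norm_L2_set plus_poly_mapping.rep_eq)

lemma l2norm_minus_commute: "l2norm m (x - y) = l2norm m (y - x)"
  by (simp add: l2norm_def dotp_simps)

lemma orth_proj_ex_span:
  assumes "finite B" "B \<subseteq> rvec m"
  shows "\<exists>y\<in>span B. \<forall>z\<in>span B. dotp m (x - y) z = 0"
  using assms
proof (induction B arbitrary: x rule: finite_induct)
  case empty
  then show ?case by (simp add: dotp_simps)
next
  case (insert b B)
  then have IH: "\<And>x. \<exists>y\<in>span B. \<forall>z\<in>span B. dotp m (x - y) z = 0" by auto
  obtain p where p: "p \<in> span B" "\<And>z. z \<in> span B \<Longrightarrow> dotp m (x - p) z = 0"
    using IH[of x] by blast
  obtain q where q: "q \<in> span B" "\<And>z. z \<in> span B \<Longrightarrow> dotp m (b - q) z = 0"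
    using IH[of b] by blast
  define e where "e = b - q"
  have sub: "span B \<subseteq> span (insert b B)" by (rule span_mono) auto
  have e_in: "e \<in> span (insert b B)"
    unfolding e_def using q(1) sub by (auto intro: span_diff span_base)
  have "span (insert b B) \<subseteq> rvec m"
    using insert.prems subspace_rvec by (metis span_minimal)
  then have e_rvec: "e \<in> rvec m" using e_in by blast
  define y where "y = p + (dotp m x e / dotp m e e) *\<^sub>R e"
  have y_in: "y \<in> span (insert b B)"
    unfolding y_def using p(1) sub e_in by (auto intro: span_add span_scale)
  have pe: "dotp m p e = 0" using q(2)[OF p(1)] by (simp add: e_def dotp_commute)
  have xye: "dotp m (x - y) e = 0"
  proof (cases "dotp m e e = 0")
    case True
    then have "e = 0" using dotp_eq_0[OF e_rvec] by simp
    then show ?thesis by (simp add: dotp_simps)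
  next
    case False
    then show ?thesis by (simp add: y_def dotp_simps pe)
  qed
  have xyB: "dotp m (x - y) z = 0" if "z \<in> span B" for z
    using p(2)[OF that] q(2)[OF that]
    by (simp add: y_def dotp_simps e_def)
  have "dotp m (x - y) z = 0" if z: "z \<in> span (insert b B)" for z
  proof -
    obtain k where "z - k *\<^sub>R b \<in> span B" using z by (auto simp: span_insert)
    then have "(z - k *\<^sub>R b) + k *\<^sub>R q \<in> span B" using q(1) by (intro span_add span_scale)
    moreover have "z = ((z - k *\<^sub>R b) + k *\<^sub>R q) + k *\<^sub>R e"
      by (simp add: e_def algebra_simps)
    ultimately show ?thesis using xye xyB by (metis add.right_neutral dotp_simps(3,6) mult_zero_right)
  qed
  then show ?case using y_in by blast
qed

lemma orth_proj_ex1: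
  assumes "subspace Y" "Y \<subseteq> rvec m"
  shows "\<exists>!y. y \<in> Y \<and> (\<forall>z\<in>Y. dotp m (x - y) z = 0)"
proof -
  define S :: "rseq set" where "S = (\<lambda>i. Poly_Mapping.single i 1) ` {..<m}"
  have "rvec m \<subseteq> span S"
  proof
    fix x assume x: "x \<in> rvec m"
    have "x = (\<Sum>i<m. Poly_Mapping.lookup x i *\<^sub>R Poly_Mapping.single i 1)"
    proof (rule poly_mapping_eqI)
      fix k
      show "Poly_Mapping.lookup x k =
          Poly_Mapping.lookup (\<Sum>i<m. Poly_Mapping.lookup x i *\<^sub>R Poly_Mapping.single i 1) k"
        using x by (auto simp: lookup_sum lookup_single when_def rvec_def in_keys_iff subset_iff
            sum.delta if_distrib cong: if_cong)
    qed
    also have "\<dots> \<in> span S"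
      by (intro span_sum span_scale span_base) (auto simp: S_def)
    finally show "x \<in> span S" .
  qed
  obtain B where B: "B \<subseteq> Y" "independent B" "Y \<subseteq> span B"
    using basis_exists by metis
  have "finite B"
    using independent_span_bound[of S B] B assms \<open>rvec m \<subseteq> span S\<close> by (auto simp: S_def)
  moreover have YB: "Y = span B"
    using B assms(1) by (metis span_minimal subset_antisym)
  ultimately obtain y where y: "y \<in> Y" "\<forall>z\<in>Y. dotp m (x - y) z = 0"
    using orth_proj_ex_span[of B m x] B assms(2) by auto
  show ?thesis
  proof (rule ex1I[of _ y])
    show "y \<in> Y \<and> (\<forall>z\<in>Y. dotp m (x - y) z = 0)" using y by blast
  next
    fix y' assume y': "y' \<in> Y \<and> (\<forall>z\<in>Y. dotp m (x - y') z = 0)"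
    then have d: "y - y' \<in> Y" using y(1) assms(1) by (simp add: subspace_diff)
    have "dotp m (x - y') (y - y') - dotp m (x - y) (y - y') = 0" using d y y' by simp
    then have "dotp m (y - y') (y - y') = 0" by (simp add: dotp_simps)
    then show "y' = y" using dotp_eq_0 d assms(2) by fastforce
  qed
qed

lemma orth_proj:
  assumes "subspace Y" "Y \<subseteq> rvec m"
  shows "orth_proj m Y x \<in> Y" "z \<in> Y \<Longrightarrow> dotp m (x - orth_proj m Y x) z = 0"
  using theI'[OF orth_proj_ex1[OF assms, of x]] unfolding orth_proj_def by blast+

lemma orth_proj_eq:
  assumes "subspace Y" "Y \<subseteq> rvec m" "y \<in> Y" "\<And>z. z \<in> Y \<Longrightarrow> dotp m (x - y) z = 0"
  shows "orth_proj m Y x = y"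
  using orth_proj_ex1[OF assms(1,2), of x] orth_proj[OF assms(1,2)] assms(3,4) by blast

lemma orth_proj_scaleR:
  assumes "subspace Y" "Y \<subseteq> rvec m"
  shows "orth_proj m Y (a *\<^sub>R x) = a *\<^sub>R orth_proj m Y x"
proof (rule orth_proj_eq[OF assms])
  show "a *\<^sub>R orth_proj m Y x \<in> Y" by (simp add: orth_proj[OF assms] assms(1) subspace_scale)
  show "dotp m (a *\<^sub>R x - a *\<^sub>R orth_proj m Y x) z = 0" if "z \<in> Y" for z
    using orth_proj(2)[OF assms that, of x] by (simp add: dotp_simps)
qed

lemma orth_proj_norm_le:
  assumes "subspace Y" "Y \<subseteq> rvec m"
  shows "l2norm m (orth_proj m Y x) \<le> l2norm m x"
proof -
  let ?p = "orth_proj m Y x"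
  have "dotp m (x - ?p) ?p = 0" by (rule orth_proj(2)[OF assms orth_proj(1)[OF assms]])
  then have "dotp m x x = dotp m ?p ?p + dotp m (x - ?p) (x - ?p)"
    by (simp add: dotp_simps dotp_commute[of m ?p x])
  then show ?thesis unfolding l2norm_def using dotp_nonneg[of m "x - ?p"] by simp
qed

lemma gap_bdd:
  assumes "Y \<in> grassmannian m n" "Z \<in> grassmannian m n"
  shows "bdd_above ((\<lambda>x. l2norm m (orth_proj m Y x - orth_proj m Z x)) `
           {x \<in> rvec m. l2norm m x \<le> 1})"
proof (rule bdd_aboveI2)
  fix x assume "x \<in> {x \<in> rvec m. l2norm m x \<le> 1}"
  moreover have "l2norm m (orth_proj m Y x - orth_proj m Z x)
      \<le> l2norm m (orth_proj m Y x) + l2norm m (0 - orth_proj m Z x)"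
    using l2norm_triangle[of m "orth_proj m Y x" "0 - orth_proj m Z x"] by simp
  ultimately show "l2norm m (orth_proj m Y x - orth_proj m Z x) \<le> 2"
    using orth_proj_norm_le[of Y m x] orth_proj_norm_le[of Z m x] assms
      l2norm_minus_commute[of m 0 "orth_proj m Z x"]
    by (simp add: grassmannian_def)
qed

lemma gap_upper:
  assumes "Y \<in> grassmannian m n" "Z \<in> grassmannian m n" "x \<in> rvec m" "l2norm m x \<le> 1"
  shows "l2norm m (orth_proj m Y x - orth_proj m Z x) \<le> gap m Y Z"
  unfolding gap_def using assms by (intro max.coboundedI2 cSUP_upper gap_bdd) auto

lemma gap_least:
  assumes "\<And>x. x \<in> rvec m \<Longrightarrow> l2norm m x \<le> 1 \<Longrightarrow>
             l2norm m (orth_proj m Y x - orth_proj m Z x) \<le> K"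
    and "0 \<le> K"
  shows "gap m Y Z \<le> K"
proof -
  have "0 \<in> {x \<in> rvec m. l2norm m x \<le> 1}"
    by (simp add: rvec_def l2norm_def dotp_simps)
  then show ?thesis unfolding gap_def by (intro max.boundedI cSUP_least) (use assms in auto)
qed

lemma gap_zero_imp_subset:
  assumes "Y \<in> grassmannian m n" "Z \<in> grassmannian m n" "gap m Y Z = 0"
  shows "Y \<subseteq> Z"
proof
  have Y: "subspace Y" "Y \<subseteq> rvec m" and Z: "subspace Z" "Z \<subseteq> rvec m"
    using assms by (auto simp: grassmannian_def)
  fix y assume y: "y \<in> Y"
  define a where "a = 1 / (1 + l2norm m y)"
  have a: "a > 0" using l2norm_nonneg[of m y] by (simp add: a_def add_pos_nonneg)
  have x: "a *\<^sub>R y \<in> rvec m" using y Y subspace_rvec by (auto intro: subspace_scale)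
  have "l2norm m (a *\<^sub>R y) = a * l2norm m y"
    using a by (simp add: l2norm_def dotp_simps real_sqrt_mult)
  also have "\<dots> \<le> 1" using l2norm_nonneg[of m y] by (simp add: a_def divide_simps)
  finally have "l2norm m (orth_proj m Y (a *\<^sub>R y) - orth_proj m Z (a *\<^sub>R y)) \<le> 0"
    using gap_upper[OF assms(1,2) x] assms(3) by simp
  moreover have "orth_proj m Y (a *\<^sub>R y) = a *\<^sub>R y"
    using y Y by (intro orth_proj_eq) (auto intro: subspace_scale simp: dotp_simps)
  moreover have "a *\<^sub>R y - orth_proj m Z (a *\<^sub>R y) \<in> rvec m"
    using x orth_proj(1)[OF Z] Z(2) subspace_rvec by (auto intro: subspace_diff)
  ultimately have "a *\<^sub>R y - orth_proj m Z (a *\<^sub>R y) = 0"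
    using dotp_nonneg[of m "a *\<^sub>R y - orth_proj m Z (a *\<^sub>R y)"]
    by (intro dotp_eq_0) (auto simp: l2norm_def)
  then have "a *\<^sub>R y = a *\<^sub>R orth_proj m Z y" by (simp add: orth_proj_scaleR[OF Z])
  then have "y = orth_proj m Z y" using a by simp
  then show "y \<in> Z" using orth_proj(1)[OF Z] by metis
qed

lemma gap_commute: "gap m Y Z = gap m Z Y"
  unfolding gap_def by (simp add: l2norm_minus_commute)

lemma gap_nonneg: "0 \<le> gap m Y Z"
  by (simp add: gap_def)

lemma Metric_space_grassmannian: "Metric_space (grassmannian m n) (gap m)"
proof
  show "0 \<le> gap m Y Z" for Y Z
    by (rule gap_nonneg)
  show "gap m Y Z = gap m Z Y" for Y Z
    by (rule gap_commute)
next
  fix Y Z assume YZ: "Y \<in> grassmannian m n" "Z \<in> grassmannian m n"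
  have "gap m Y Y \<le> 0" by (rule gap_least) (simp_all add: l2norm_def dotp_simps)
  then have "gap m Y Y = 0" using gap_nonneg[of m Y Y] by simp
  then show "gap m Y Z = 0 \<longleftrightarrow> Y = Z"
    using gap_zero_imp_subset[OF YZ] gap_zero_imp_subset[OF YZ(2,1)] gap_commute[of m Y Z] by auto
next
  fix X Y Z
  assume A: "X \<in> grassmannian m n" "Y \<in> grassmannian m n" "Z \<in> grassmannian m n"
  show "gap m X Z \<le> gap m X Y + gap m Y Z"
  proof (rule gap_least)
    fix x assume x: "x \<in> rvec m" "l2norm m x \<le> 1"
    show "l2norm m (orth_proj m X x - orth_proj m Z x) \<le> gap m X Y + gap m Y Z"
      using l2norm_triangle[of m "orth_proj m X x - orth_proj m Y x"
          "orth_proj m Y x - orth_proj m Z x"]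
        gap_upper[OF A(1,2) x] gap_upper[OF A(2,3) x]
      by simp
  qed (simp add: gap_nonneg)
qed

end

theory Submission
  imports Defs
begin

text \<open>
  Exact recovery for \<open>Y\<close> is equivalent to the null space property: every nonzero \<open>u \<in> Y\<close> has less
  \<open>\<parallel>\<cdot>\<parallel>\<^sub>1\<close>-mass on any \<open>r\<close> coordinates than on the remaining ones. Let \<open>h x\<close> be the distance from \<open>x\<close> to \<open>Y\<close>.
  It suffices that \<open>(h k)\<^sup>2\<close> lies within constant factors of its mean \<open>(R / m) \<parallel>k\<parallel>\<^sup>2\<close> for all integer
  vectors \<open>k\<close> with \<open>\<parallel>k\<parallel>\<^sub>1 \<le> 1024 r\<close>: a violating \<open>u\<close>, scaled to \<open>\<parallel>u\<parallel>\<^sub>1 = 1024 r\<close>, is the sum of such a \<open>k\<close>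
  with large \<open>\<parallel>k\<parallel>\<close> and a remainder \<open>w\<close> in the convex hull of such vectors with entries in \<open>{-1, 0, 1}\<close>,
  for which \<open>h w\<close> is too small to equal \<open>h k\<close>. There are at most \<open>exp (O (r log (m / r)))\<close> such \<open>k\<close>, so
  a union bound applies. For a single \<open>k\<close>, rotation invariance allows replacing \<open>k\<close> by an independent
  Gaussian vector, after which \<open>Y\<close> can be fixed and Chernoff's bound applies to the Gaussian vector.
\<close>

section \<open>Orthonormal systems\<close>

lemma dotp_sum_left: "dotp m (\<Sum>i\<in>A. f i) y = (\<Sum>i\<in>A. dotp m (f i) y)"
  by (induction A rule: infinite_finite_induct) (auto simp: dotp_simps)

lemma dotp_sum_right: "dotp m y (\<Sum>i\<in>A. f i) = (\<Sum>i\<in>A. dotp m y (f i))"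
  by (induction A rule: infinite_finite_induct) (auto simp: dotp_simps)

lemma l2norm_power2: "(l2norm m x)\<^sup>2 = dotp m x x"
  by (simp add: l2norm_def dotp_nonneg)

definition orthonormal :: "nat \<Rightarrow> rseq set \<Rightarrow> bool" where
  "orthonormal m E \<longleftrightarrow> finite E \<and> E \<subseteq> rvec m \<and>
     (\<forall>a\<in>E. \<forall>b\<in>E. dotp m a b = (if a = b then 1 else 0))"

lemma orthonormal_dotp_combination:
  assumes "orthonormal m E" "b \<in> E"
  shows "dotp m (\<Sum>a\<in>E. c a *\<^sub>R a) b = c b"
proof -
  have "dotp m (\<Sum>a\<in>E. c a *\<^sub>R a) b = (\<Sum>a\<in>E. if a = b then c a else 0)"
    unfolding dotp_sum_left using assms
    by (intro sum.cong) (auto simp: dotp_simps orthonormal_def)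
  then show ?thesis using assms by (simp add: orthonormal_def)
qed

lemma orthonormal_dotp_self_combination:
  assumes "orthonormal m E"
  shows "dotp m (\<Sum>a\<in>E. c a *\<^sub>R a) (\<Sum>a\<in>E. c a *\<^sub>R a) = (\<Sum>a\<in>E. (c a)\<^sup>2)"
proof -
  have "dotp m (\<Sum>a\<in>E. c a *\<^sub>R a) (\<Sum>a\<in>E. c a *\<^sub>R a)
      = (\<Sum>b\<in>E. c b * dotp m (\<Sum>a\<in>E. c a *\<^sub>R a) b)"
    by (subst (1) dotp_sum_right) (simp add: dotp_simps)
  also have "\<dots> = (\<Sum>b\<in>E. (c b)\<^sup>2)"
    using orthonormal_dotp_combination[OF assms] by (simp add: power2_eq_square)
  finally show ?thesis .
qed

lemma span_subset_rvec: "E \<subseteq> rvec m \<Longrightarrow> span E \<subseteq> rvec m"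
  by (simp add: span_minimal subspace_rvec)

lemma orth_proj_orthonormal:
  assumes "orthonormal m E"
  shows "orth_proj m (span E) x = (\<Sum>a\<in>E. dotp m x a *\<^sub>R a)" (is "_ = ?y")
proof (rule orth_proj_eq)
  show "span E \<subseteq> rvec m" using assms by (simp add: orthonormal_def span_subset_rvec)
  show "?y \<in> span E" by (intro span_sum span_scale span_base)
  have "span E \<subseteq> {z. dotp m (x - ?y) z = 0}"
    using orthonormal_dotp_combination[OF assms]
    by (intro span_minimal) (auto simp: subspace_def dotp_simps)
  then show "dotp m (x - ?y) z = 0" if "z \<in> span E" for z
    using that by blast
qed simp

lemma dotp_orth_proj_orthonormal:
  assumes "orthonormal m E"
  shows "dotp m (orth_proj m (span E) x) (orth_proj m (span E) x) = (\<Sum>a\<in>E. (dotp m x a)\<^sup>2)"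
  by (simp add: orth_proj_orthonormal[OF assms] orthonormal_dotp_self_combination[OF assms])

lemma orth_proj_id:
  assumes "subspace Y" "Y \<subseteq> rvec m" "y \<in> Y"
  shows "orth_proj m Y y = y"
  using assms by (intro orth_proj_eq) (auto simp: dotp_simps)

lemma orthonormal_independent:
  assumes "orthonormal m E"
  shows "independent E"
proof (rule independent_if_scalars_zero)
  show "finite E" using assms by (simp add: orthonormal_def)
  fix u v assume "(\<Sum>v\<in>E. u v *\<^sub>R v) = 0" "v \<in> E"
  then show "u v = 0"
    using orthonormal_dotp_combination[OF assms, of v u] by (simp add: dotp_simps)
qed

section \<open>The coordinate basis, dimension counts and completion of orthonormal systems\<close>

definition unit_vectors :: "nat \<Rightarrow> rseq set" where
  "unit_vectors m = (\<lambda>i. Poly_Mapping.single i 1) ` {..<m}"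

lemma orthonormal_unit_vectors: "orthonormal m (unit_vectors m)"
proof -
  have "dotp m (Poly_Mapping.single i 1) (Poly_Mapping.single j 1) = (if i = j then 1 else 0)"
    if "i < m" for i j
    using that by (simp add: dotp_def lookup_single when_def if_distrib[of "\<lambda>t. t * _"] cong: if_cong)
  then show ?thesis
    by (auto simp: orthonormal_def unit_vectors_def rvec_def single_one[symmetric] inj_eq inj_on_def
        dest: arg_cong[of _ _ "\<lambda>p. Poly_Mapping.keys p"])
qed

lemma span_unit_vectors: "span (unit_vectors m) = rvec m"
proof
  show "span (unit_vectors m) \<subseteq> rvec m"
    using orthonormal_unit_vectors by (simp add: orthonormal_def span_subset_rvec)
  show "rvec m \<subseteq> span (unit_vectors m)"
  proof
    fix x assume x: "x \<in> rvec m"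
    have "x = (\<Sum>i<m. Poly_Mapping.lookup x i *\<^sub>R Poly_Mapping.single i 1)"
    proof (rule poly_mapping_eqI)
      fix k
      show "Poly_Mapping.lookup x k =
          Poly_Mapping.lookup (\<Sum>i<m. Poly_Mapping.lookup x i *\<^sub>R Poly_Mapping.single i 1) k"
        using x by (auto simp: lookup_sum lookup_single when_def rvec_def in_keys_iff subset_iff
            sum.delta if_distrib cong: if_cong)
    qed
    also have "\<dots> \<in> span (unit_vectors m)"
      by (intro span_sum span_scale span_base) (auto simp: unit_vectors_def)
    finally show "x \<in> span (unit_vectors m)" .
  qed
qed

lemma card_unit_vectors: "card (unit_vectors m) = m"
proof -
  have "inj_on (\<lambda>i. Poly_Mapping.single i (1::real)) {..<m}"
    by (rule inj_onI) (metis lookup_single_eq lookup_single_not_eq zero_neq_one)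
  then show ?thesis by (simp add: unit_vectors_def card_image)
qed

lemma orthonormal_card:
  assumes "orthonormal m E" "span E = W"
  shows "card E = dim W"
  using assms orthonormal_independent[OF assms(1)] by (metis dim_eq_card_independent dim_span)

lemma dim_rvec: "dim (rvec m) = m"
  using orthonormal_card[OF orthonormal_unit_vectors span_unit_vectors] by (simp add: card_unit_vectors)

lemma orthonormal_card_le:
  assumes "orthonormal m E"
  shows "card E \<le> m"
proof -
  have "E \<subseteq> span (unit_vectors m)" using assms by (simp add: span_unit_vectors orthonormal_def)
  then show ?thesis
    using independent_span_bound[of "unit_vectors m" E] orthonormal_independent[OF assms]
    by (simp add: card_unit_vectors) (simp add: unit_vectors_def)
qed

text \<open>Gram-Schmidt: the normalised residual of a vector of \<open>W\<close> outside
  \<open>span E\<close> enlarges \<open>E\<close>, and the process stops because an orthonormal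
  system has at most \<open>m\<close> elements. Allowing an arbitrary initial \<open>E\<close> makes
  it possible to complete a basis of \<open>Y\<close> to one of the whole space.\<close>

lemma orthonormal_extend:
  assumes "orthonormal m E" "E \<subseteq> W" "subspace W" "W \<subseteq> rvec m"
  shows "\<exists>F. E \<subseteq> F \<and> orthonormal m F \<and> span F = W"
  using assms(1,2)
proof (induction "m - card E" arbitrary: E rule: less_induct)
  case less
  have subW: "span E \<subseteq> W" using less.prems assms(3) by (simp add: span_minimal)
  have subE: "subspace (span E)" "span E \<subseteq> rvec m" using subW assms(4) by auto
  show ?case
  proof (cases "span E = W")
    case False
    then obtain w where w: "w \<in> W" "w \<notin> span E" using subW by blast
    define e where "e = w - orth_proj m (span E) w"
    have eE: "dotp m e z = 0" if "z \<in> span E" for z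
      using orth_proj(2)[OF subE that] by (simp add: e_def)
    have eW: "e \<in> W" unfolding e_def
      using w orth_proj(1)[OF subE] subW assms(3) by (auto intro: subspace_diff)
    have "e \<noteq> 0" using w orth_proj(1)[OF subE, of w] by (auto simp: e_def)
    then have e0: "dotp m e e > 0" using dotp_eq_0 dotp_nonneg eW assms(4)
      by (metis order_le_less subsetD)
    define f where "f = (1 / l2norm m e) *\<^sub>R e"
    have ff: "dotp m f f = 1"
      using e0 by (simp add: f_def dotp_simps l2norm_def real_sqrt_mult[symmetric])
    have fE: "dotp m f z = 0" "dotp m z f = 0" if "z \<in> E" for z
      using eE[of z] that by (simp_all add: f_def dotp_simps span_base dotp_commute[of m z])
    have fW: "f \<in> W" using eW assms(3) by (simp add: f_def subspace_scale)
    have fnE: "f \<notin> E" using fE ff by force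
    have on: "orthonormal m (insert f E)"
      using less.prems(1) ff fE fW fnE assms(4) by (auto simp: orthonormal_def)
    have "card (insert f E) = Suc (card E)" using fnE less.prems by (simp add: orthonormal_def)
    then have "m - card (insert f E) < m - card E" using orthonormal_card_le[OF on] by linarith
    then show ?thesis using less.hyps[OF _ on] fW less.prems(2) by blast
  qed (use less.prems in blast)
qed

lemma orthonormal_basis_exists:
  assumes "subspace W" "W \<subseteq> rvec m"
  obtains E where "orthonormal m E" "span E = W"
  using orthonormal_extend[of m "{}" W] assms by (auto simp: orthonormal_def)

text \<open>\<open>D\<close> is an orthonormal basis of the orthogonal complement of \<open>Y\<close>.\<close>

lemma grassmannian_orthonormal_bases:
  assumes "Y \<in> grassmannian m n"
  obtains E D where "orthonormal m E" "orthonormal m D" "span E = Y" "card E = n" "card D = m - n"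
    "\<And>x. x \<in> rvec m \<Longrightarrow> dotp m x x = (\<Sum>a\<in>E. (dotp m x a)\<^sup>2) + (\<Sum>a\<in>D. (dotp m x a)\<^sup>2)"
proof -
  have Y: "subspace Y" "Y \<subseteq> rvec m" "dim Y = n" using assms by (auto simp: grassmannian_def)
  obtain E where E: "orthonormal m E" "span E = Y" using orthonormal_basis_exists Y by metis
  obtain F where F: "E \<subseteq> F" "orthonormal m F" "span F = rvec m"
    using orthonormal_extend[OF E(1) _ subspace_rvec order_refl] E(1) unfolding orthonormal_def by blast
  have cE: "card E = n" using orthonormal_card[OF E] Y by simp
  have cF: "card F = m" using orthonormal_card[OF F(2,3)] by (simp add: dim_rvec)
  have fin: "finite F" "finite E" using F(2) E(1) by (auto simp: orthonormal_def)
  show thesis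
  proof (rule that[of E "F - E"])
    show "orthonormal m (F - E)" using F(2) by (auto simp: orthonormal_def)
    show "card (F - E) = m - n" using cE cF F(1) fin by (simp add: card_Diff_subset)
    fix x assume "x \<in> rvec m"
    then have "orth_proj m (span F) x = x" using F(3) by (simp add: orth_proj_id subspace_rvec)
    then have "dotp m x x = (\<Sum>a\<in>F. (dotp m x a)\<^sup>2)"
      using dotp_orth_proj_orthonormal[OF F(2), of x] by simp
    then show "dotp m x x = (\<Sum>a\<in>E. (dotp m x a)\<^sup>2) + (\<Sum>a\<in>F - E. (dotp m x a)\<^sup>2)"
      using F(1) fin by (simp add: sum.subset_diff[of E F] add.commute)
  qed (use E cE in auto)
qed

section \<open>Gaussian integrals\<close>

abbreviation std_gauss :: "real measure" where
  "std_gauss \<equiv> density lborel (\<lambda>x. ennreal (std_normal_density x))"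

lemma prob_space_std_gauss: "prob_space std_gauss"
  using prob_space_normal_density[of 1 0] by simp

text \<open>Completing the square turns the integrand into a constant times the normal density with
  mean \<open>a / (1 + \<alpha>)\<close> and variance \<open>1 / (1 + \<alpha>)\<close>; the
  hypothesis on \<alpha> makes this variance positive.\<close>

lemma nn_integral_std_gauss_exp:
  fixes \<alpha> a :: real
  assumes "\<alpha> > -1"
  shows "(\<integral>\<^sup>+x. ennreal (exp (a * x - \<alpha> * x\<^sup>2 / 2)) \<partial>std_gauss)
     = ennreal (exp (a\<^sup>2 / (2 * (1 + \<alpha>))) * (1 + \<alpha>) powr (-1/2))"
proof -
  define \<sigma> where "\<sigma> = 1 / sqrt (1 + \<alpha>)"
  define K where "K = exp (a\<^sup>2 / (2 * (1 + \<alpha>))) * (1 + \<alpha>) powr (-1/2)"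
  have pos: "1 + \<alpha> > 0" "\<sigma> > 0" using assms by (auto simp: \<sigma>_def)
  have \<sigma>2: "\<sigma>\<^sup>2 = 1 / (1 + \<alpha>)" using pos by (simp add: \<sigma>_def power_divide)
  have "(1 + \<alpha>) powr (-1/2) = 1 / (1 + \<alpha>) powr (1/2)"
    using powr_minus_divide[of "1 + \<alpha>" "1/2"] by simp
  also have "\<dots> = \<sigma>" unfolding \<sigma>_def using powr_half_sqrt[of "1 + \<alpha>"] pos by simp
  finally have K: "K = exp (a\<^sup>2 / (2 * (1 + \<alpha>))) * \<sigma>" by (simp add: K_def)
  have eq: "std_normal_density x * exp (a * x - \<alpha> * x\<^sup>2 / 2)
      = K * normal_density (a / (1 + \<alpha>)) \<sigma> x" for x
  proof -
    have "- x\<^sup>2 / 2 + (a * x - \<alpha> * x\<^sup>2 / 2)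
        = a\<^sup>2 / (2 * (1 + \<alpha>)) + - (x - a / (1 + \<alpha>))\<^sup>2 / (2 * \<sigma>\<^sup>2)"
    proof -
      define t where "t = 1 + \<alpha>"
      define u where "u = a / t"
      have t: "t > 0" "\<alpha> = t - 1" "a = u * t" using pos by (auto simp: t_def u_def)
      have "a\<^sup>2 / (2 * t) = u\<^sup>2 * t / 2" "(x - u)\<^sup>2 / (2 * (1 / t)) = t * (x - u)\<^sup>2 / 2"
        using t by (simp_all add: power2_eq_square)
      then show ?thesis
        unfolding \<sigma>2 t_def[symmetric] u_def[symmetric] minus_divide_left[symmetric] unfolding t(2,3)
        by (simp add: power2_eq_square algebra_simps add_divide_distrib diff_divide_distrib)
    qed
    then have "exp (- x\<^sup>2 / 2) * exp (a * x - \<alpha> * x\<^sup>2 / 2)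
        = exp (a\<^sup>2 / (2 * (1 + \<alpha>))) * exp (- (x - a / (1 + \<alpha>))\<^sup>2 / (2 * \<sigma>\<^sup>2))"
      by (simp only: exp_add[symmetric])
    moreover have "normal_density \<nu> \<sigma> x = (1 / sqrt (2 * pi)) * exp (- (x - \<nu>)\<^sup>2 / (2 * \<sigma>\<^sup>2)) / \<sigma>" for \<nu>
      using pos by (simp add: normal_density_def real_sqrt_mult)
    ultimately show ?thesis using pos by (simp add: std_normal_density_def K)
  qed
  have "(\<integral>\<^sup>+x. ennreal (exp (a * x - \<alpha> * x\<^sup>2 / 2)) \<partial>std_gauss)
      = (\<integral>\<^sup>+x. ennreal K * ennreal (normal_density (a / (1 + \<alpha>)) \<sigma> x) \<partial>lborel)"
    by (subst nn_integral_density)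
       (auto simp: ennreal_mult[symmetric] eq K_def intro!: nn_integral_cong)
  also have "\<dots> = ennreal K"
    by (subst nn_integral_cmult)
      (use pos in \<open>auto simp: nn_integral_eq_integral integrable_normal_density integral_normal_density\<close>)
  finally show ?thesis by (simp add: K_def)
qed

abbreviation gauss_prod :: "'i set \<Rightarrow> ('i \<Rightarrow> real) measure" where
  "gauss_prod I \<equiv> Pi\<^sub>M I (\<lambda>_. std_gauss)"

lemma prob_space_gauss_prod: "prob_space (gauss_prod I)"
  by (rule prob_space_PiM) (rule prob_space_std_gauss)

text \<open>The exponent is a sum over coordinates, so the integral factorises into the
  one-dimensional ones.\<close>

lemma nn_integral_gauss_prod_exp:
  fixes \<alpha> :: real and a :: "'i \<Rightarrow> real"
  assumes "\<alpha> > -1" "finite I"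
  shows "(\<integral>\<^sup>+x. ennreal (exp ((\<Sum>i\<in>I. a i * x i) - \<alpha> * (\<Sum>i\<in>I. (x i)\<^sup>2) / 2)) \<partial>gauss_prod I)
     = ennreal (exp ((\<Sum>i\<in>I. (a i)\<^sup>2) / (2 * (1 + \<alpha>))) * (1 + \<alpha>) powr (- real (card I) / 2))"
proof -
  interpret product_prob_space "\<lambda>_::'i. std_gauss" I
    by (simp add: product_prob_space_def product_prob_space_axioms_def product_sigma_finite_def
        prob_space_std_gauss prob_space_imp_sigma_finite)
  have "(\<integral>\<^sup>+x. ennreal (exp ((\<Sum>i\<in>I. a i * x i) - \<alpha> * (\<Sum>i\<in>I. (x i)\<^sup>2) / 2)) \<partial>gauss_prod I)
      = (\<integral>\<^sup>+x. (\<Prod>i\<in>I. ennreal (exp (a i * x i - \<alpha> * (x i)\<^sup>2 / 2))) \<partial>gauss_prod I)"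
    using assms(2)
    by (simp add: prod_ennreal exp_sum[symmetric] sum_subtractf sum_distrib_left sum_divide_distrib)
  also have "\<dots> = (\<Prod>i\<in>I. ennreal (exp ((a i)\<^sup>2 / (2 * (1 + \<alpha>))) * (1 + \<alpha>) powr (-1/2)))"
    using assms by (subst product_nn_integral_prod) (auto simp: nn_integral_std_gauss_exp)
  also have "\<dots> = ennreal (exp ((\<Sum>i\<in>I. (a i)\<^sup>2) / (2 * (1 + \<alpha>))) * ((1 + \<alpha>) powr (-1/2)) ^ card I)"
    using assms by (simp add: prod_ennreal prod.distrib exp_sum[symmetric] sum_divide_distrib)
  also have "((1 + \<alpha>) powr (-1/2)) ^ card I = (1 + \<alpha>) powr (- real (card I) / 2)"
    using assms by (simp add: powr_realpow[symmetric] powr_powr)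
  finally show ?thesis .
qed

text \<open>Points of \<open>gauss_prod {..<m}\<close> are \<open>undefined\<close> outside
  \<open>{..<m}\<close>; cutting off at \<open>m\<close> yields a genuine element of
  \<open>rvec m\<close>.\<close>

definition vec_of :: "nat \<Rightarrow> (nat \<Rightarrow> real) \<Rightarrow> rseq" where
  "vec_of m g = (\<Sum>i<m. g i *\<^sub>R Poly_Mapping.single i 1)"

lemma lookup_vec_of: "Poly_Mapping.lookup (vec_of m g) i = (if i < m then g i else 0)"
  by (auto simp: vec_of_def lookup_sum lookup_single when_def if_distrib sum.delta cong: if_cong)

lemma vec_of_in_rvec: "vec_of m g \<in> rvec m"
  by (auto simp: rvec_def in_keys_iff lookup_vec_of split: if_splits)

lemma dotp_vec_of: "dotp m (vec_of m g) x = (\<Sum>i<m. Poly_Mapping.lookup x i * g i)"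
  by (simp add: dotp_def lookup_vec_of mult.commute)

lemma dotp_vec_of_self: "dotp m (vec_of m g) (vec_of m g) = (\<Sum>i<m. (g i)\<^sup>2)"
  by (simp add: dotp_def lookup_vec_of power2_eq_square)

lemma measurable_gauss_prod_component [measurable]:
  "i \<in> I \<Longrightarrow> (\<lambda>x. x i) \<in> borel_measurable (gauss_prod I)"
  using measurable_component_singleton[of i I "\<lambda>_. std_gauss"] by simp

text \<open>Decoupling: \<open>exp (s q\<^sup>2 / 2)\<close> is the Gaussian mean of \<open>exp (\<surd>s q h)\<close> over \<open>h\<close>, which turns the
  quadratic exponent in \<open>g\<close> into a linear one.\<close>

lemma nn_integral_gauss_quadratic:
  fixes \<alpha> s :: real
  assumes E: "orthonormal m E" and s: "0 \<le> s" "s < 1 + \<alpha>"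
  shows "(\<integral>\<^sup>+g. ennreal (exp (s * (\<Sum>b\<in>E. (dotp m (vec_of m g) b)\<^sup>2) / 2
             - \<alpha> * dotp m (vec_of m g) (vec_of m g) / 2)) \<partial>gauss_prod {..<m})
     = ennreal ((1 + \<alpha>) powr (- real m / 2) * (1 - s / (1 + \<alpha>)) powr (- real (card E) / 2))"
proof -
  have fin: "finite E" using E by (simp add: orthonormal_def)
  have \<alpha>: "\<alpha> > -1" using s by linarith
  interpret P: pair_sigma_finite "gauss_prod {..<m}" "gauss_prod E"
    by (simp add: pair_sigma_finite_def prob_space_gauss_prod prob_space_imp_sigma_finite)
  let ?G = "gauss_prod {..<m}" and ?H = "gauss_prod E"
  let ?q = "\<lambda>g b. dotp m (vec_of m g) b"
  define N where "N g = (\<Sum>i<m. (g i)\<^sup>2)" for g :: "nat \<Rightarrow> real"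
  let ?f = "\<lambda>g h. ennreal (exp (sqrt s * (\<Sum>b\<in>E. ?q g b * h b) - \<alpha> * N g / 2))"
  \<comment> \<open>For fixed \<open>g\<close> the integral over \<open>h\<close> has linear
    coefficients \<open>sqrt s * ?q g b\<close> and no quadratic term, so it restores the quadratic
    exponent.\<close>
  have inner_h: "(\<integral>\<^sup>+h. ?f g h \<partial>?H)
      = ennreal (exp (s * (\<Sum>b\<in>E. (?q g b)\<^sup>2) / 2 - \<alpha> * N g / 2))" for g
  proof -
    have "(\<Sum>b\<in>E. (sqrt s * ?q g b) * h b) = sqrt s * (\<Sum>b\<in>E. ?q g b * h b)" for h
      by (simp add: sum_distrib_left mult.assoc)
    then have "?f g h = ennreal (exp (- \<alpha> * N g / 2))
        * ennreal (exp ((\<Sum>b\<in>E. (sqrt s * ?q g b) * h b) - 0 * (\<Sum>b\<in>E. (h b)\<^sup>2) / 2))" for h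
      by (simp add: ennreal_mult[symmetric] mult_exp_exp)
    then have "(\<integral>\<^sup>+h. ?f g h \<partial>?H) = (\<integral>\<^sup>+h. ennreal (exp (- \<alpha> * N g / 2))
        * ennreal (exp ((\<Sum>b\<in>E. (sqrt s * ?q g b) * h b) - 0 * (\<Sum>b\<in>E. (h b)\<^sup>2) / 2)) \<partial>?H)"
      by presburger
    also have "\<dots> = ennreal (exp (- \<alpha> * N g / 2)) * (\<integral>\<^sup>+h. 
        ennreal (exp ((\<Sum>b\<in>E. (sqrt s * ?q g b) * h b) - 0 * (\<Sum>b\<in>E. (h b)\<^sup>2) / 2)) \<partial>?H)"
      by (rule nn_integral_cmult) measurable
    also have "\<dots> = ennreal (exp (- \<alpha> * N g / 2))
        * ennreal (exp ((\<Sum>b\<in>E. (sqrt s * ?q g b)\<^sup>2) / 2))"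
      by (subst nn_integral_gauss_prod_exp) (use fin in simp_all)
    also have "(\<Sum>b\<in>E. (sqrt s * ?q g b)\<^sup>2) = s * (\<Sum>b\<in>E. (?q g b)\<^sup>2)"
      using s by (simp add: power_mult_distrib sum_distrib_left)
    finally show ?thesis
      by (simp add: ennreal_mult[symmetric] mult_exp_exp)
  qed
  \<comment> \<open>For fixed \<open>h\<close> the exponent is linear in \<open>g\<close> with
    coefficient vector \<open>sqrt s *\<^sub>R v\<close>, whose squared length is \<open>s\<close>
    times the sum of the \<open>(h b)\<^sup>2\<close> by orthonormality. What is left is a quadratic
    exponent in \<open>h\<close> alone.\<close>
  have inner_g: "(\<integral>\<^sup>+g. ?f g h \<partial>?G) = ennreal ((1 + \<alpha>) powr (- real m / 2)) *
      ennreal (exp ((\<Sum>b\<in>E. 0 * h b) - (- s / (1 + \<alpha>)) * (\<Sum>b\<in>E. (h b)\<^sup>2) / 2))" for h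
  proof -
    define v where "v = (\<Sum>b\<in>E. h b *\<^sub>R b)"
    have v: "v \<in> rvec m" unfolding v_def
      using E subspace_rvec by (auto simp: orthonormal_def intro!: subspace_sum subspace_scale)
    have vv: "(\<Sum>i<m. (Poly_Mapping.lookup v i)\<^sup>2) = (\<Sum>b\<in>E. (h b)\<^sup>2)"
      using orthonormal_dotp_self_combination[OF E, of h]
      by (simp add: v_def[symmetric] dotp_def power2_eq_square)
    have "(\<Sum>b\<in>E. ?q g b * h b) = dotp m (vec_of m g) v" for g
      by (simp add: v_def dotp_sum_right dotp_simps mult.commute)
    then have "sqrt s * (\<Sum>b\<in>E. ?q g b * h b) = (\<Sum>i<m. (sqrt s * Poly_Mapping.lookup v i) * g i)" for g
      by (simp add: dotp_vec_of sum_distrib_left mult.assoc)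
    then have "(\<integral>\<^sup>+g. ?f g h \<partial>?G) = (\<integral>\<^sup>+g. ennreal (exp ((\<Sum>i<m. (sqrt s * Poly_Mapping.lookup v i) * g i)
          - \<alpha> * (\<Sum>i<m. (g i)\<^sup>2) / 2)) \<partial>?G)"
      unfolding N_def by presburger
    also have "\<dots> = ennreal (exp ((\<Sum>i<m. (sqrt s * Poly_Mapping.lookup v i)\<^sup>2) / (2 * (1 + \<alpha>)))
        * (1 + \<alpha>) powr (- real m / 2))"
      using \<alpha> by (subst nn_integral_gauss_prod_exp) simp_all
    also have "(\<Sum>i<m. (sqrt s * Poly_Mapping.lookup v i)\<^sup>2) = s * (\<Sum>b\<in>E. (h b)\<^sup>2)"
      using s by (simp add: power_mult_distrib sum_distrib_left[symmetric] vv)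
    also have "s * (\<Sum>b\<in>E. (h b)\<^sup>2) / (2 * (1 + \<alpha>)) 
        = (\<Sum>b\<in>E. 0 * h b) - (- s / (1 + \<alpha>)) * (\<Sum>b\<in>E. (h b)\<^sup>2) / 2" by simp
    finally show ?thesis by (simp add: ennreal_mult[symmetric] mult.commute)
  qed
  have "(\<lambda>(g, h). ?f g h) \<in> borel_measurable (?G \<Otimes>\<^sub>M ?H)"
    unfolding dotp_vec_of N_def by measurable
  have "(\<integral>\<^sup>+g. ennreal (exp (s * (\<Sum>b\<in>E. (?q g b)\<^sup>2) / 2
             - \<alpha> * dotp m (vec_of m g) (vec_of m g) / 2)) \<partial>?G)
      = (\<integral>\<^sup>+g. \<integral>\<^sup>+h. ?f g h \<partial>?H \<partial>?G)"
    by (simp only: inner_h dotp_vec_of_self N_def[symmetric])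
  also have "\<dots> = (\<integral>\<^sup>+h. \<integral>\<^sup>+g. ?f g h \<partial>?G \<partial>?H)"
    by (rule P.Fubini'[symmetric]) fact
  also have "\<dots> = ennreal ((1 + \<alpha>) powr (- real m / 2)) * 
      (\<integral>\<^sup>+h. ennreal (exp ((\<Sum>b\<in>E. 0 * h b) - (- s / (1 + \<alpha>)) * (\<Sum>b\<in>E. (h b)\<^sup>2) / 2)) \<partial>?H)"
    unfolding inner_g
  proof (rule nn_integral_cmult)
    show "(\<lambda>h. ennreal (exp ((\<Sum>b\<in>E. 0 * h b) - (- s / (1 + \<alpha>)) * (\<Sum>b\<in>E. (h b)\<^sup>2) / 2)))
      \<in> borel_measurable ?H" by measurable
  qed
  \<comment> \<open>The remaining Gaussian integral has quadratic weight
    \<open>- s / (1 + \<alpha>)\<close>, which exceeds -1 exactly because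
    \<open>s < 1 + \<alpha>\<close>.\<close>
  also have "\<dots> = ennreal ((1 + \<alpha>) powr (- real m / 2))
      * ennreal ((1 - s / (1 + \<alpha>)) powr (- real (card E) / 2))"
    by (subst nn_integral_gauss_prod_exp) (use s \<alpha> fin in \<open>simp_all add: field_simps\<close>)
  finally show ?thesis by (simp add: ennreal_mult[symmetric])
qed

section \<open>The Borel structure of the Grassmannian and its reflections\<close>

lemma grassmannianD:
  assumes "Y \<in> grassmannian m n"
  shows "subspace Y" "Y \<subseteq> rvec m" "dim Y = n"
  using assms by (auto simp: grassmannian_def)

lemma sets_grassmannian_borel:
  "sets (grassmannian_borel m n) = sigma_sets (grassmannian m n)
     {A. openin (Metric_space.mtopology (grassmannian m n) (gap m)) A}"
proof -
  interpret Metric_space "grassmannian m n" "gap m" by (rule Metric_space_grassmannian)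
  show ?thesis unfolding grassmannian_borel_def
    using openin_subset by (intro sets_measure_of) force
qed

lemma space_grassmannian_borel: "space (grassmannian_borel m n) = grassmannian m n"
  by (simp add: grassmannian_borel_def space_measure_of_conv)

lemma openin_grassmannian:
  "openin (Metric_space.mtopology (grassmannian m n) (gap m)) A \<longleftrightarrow> A \<subseteq> grassmannian m n \<and>
     (\<forall>Y\<in>A. \<exists>d>0. \<forall>Z\<in>grassmannian m n. gap m Y Z < d \<longrightarrow> Z \<in> A)"
proof -
  interpret Metric_space "grassmannian m n" "gap m" by (rule Metric_space_grassmannian)
  show ?thesis unfolding openin_mtopology mball_def by (intro conj_cong ball_cong) blast+
qed

lemma open_in_sets_grassmannian_borel:
  assumes "A \<subseteq> grassmannian m n"
    and "\<And>Y. Y \<in> A \<Longrightarrow> \<exists>d>0. \<forall>Z\<in>grassmannian m n. gap m Y Z < d \<longrightarrow> Z \<in> A"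
  shows "A \<in> sets (grassmannian_borel m n)"
  unfolding sets_grassmannian_borel using assms by (intro sigma_sets.Basic) (simp add: openin_grassmannian)

text \<open>A function that is 1-Lipschitz for the gap metric is continuous, and the sigma-algebra
  is generated by the open sets of that metric.\<close>

lemma lipschitz_borel_measurable_grassmannian:
  fixes f :: "rseq set \<Rightarrow> real"
  assumes "\<And>Y Z. Y \<in> grassmannian m n \<Longrightarrow> Z \<in> grassmannian m n \<Longrightarrow> \<bar>f Y - f Z\<bar> \<le> gap m Y Z"
  shows "f \<in> borel_measurable (grassmannian_borel m n)"
proof (rule borel_measurableI)
  fix S :: "real set" assume S: "open S"
  show "f -` S \<inter> space (grassmannian_borel m n) \<in> sets (grassmannian_borel m n)"
    unfolding space_grassmannian_borel
  proof (rule open_in_sets_grassmannian_borel)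
    fix Y assume "Y \<in> f -` S \<inter> grassmannian m n"
    then obtain d where "d > 0" "\<And>y. dist y (f Y) < d \<Longrightarrow> y \<in> S" and Y: "Y \<in> grassmannian m n"
      using S unfolding open_dist by blast
    then show "\<exists>d>0. \<forall>Z\<in>grassmannian m n. gap m Y Z < d \<longrightarrow> Z \<in> f -` S \<inter> grassmannian m n"
      using assms[OF Y] by (intro exI[of _ d]) (force simp: dist_real_def abs_minus_commute)
  qed simp
qed

section \<open>Measurability of the matrix entries of the orthogonal projection\<close>

lemma linear_orth_proj:
  assumes "subspace Y" "Y \<subseteq> rvec m"
  shows "linear (orth_proj m Y)"
proof (rule linearI)
  show "orth_proj m Y (x + y) = orth_proj m Y x + orth_proj m Y y" for x y
  proof (rule orth_proj_eq[OF assms])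
    show "orth_proj m Y x + orth_proj m Y y \<in> Y" by (simp add: orth_proj[OF assms] assms subspace_add)
    show "dotp m (x + y - (orth_proj m Y x + orth_proj m Y y)) z = 0" if "z \<in> Y" for z
      using orth_proj(2)[OF assms that, of x] orth_proj(2)[OF assms that, of y]
      by (simp add: dotp_simps)
  qed
qed (rule orth_proj_scaleR[OF assms])

lemma dotp_orth_proj_self:
  assumes "subspace Y" "Y \<subseteq> rvec m"
  shows "dotp m (orth_proj m Y x) (orth_proj m Y x) = dotp m (orth_proj m Y x) x"
  using orth_proj(2)[OF assms orth_proj(1)[OF assms], of x x]
  by (simp add: dotp_simps dotp_commute)

lemma abs_lookup_le_l2norm: "i < m \<Longrightarrow> \<bar>Poly_Mapping.lookup x i\<bar> \<le> l2norm m x"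
  using member_le_L2_set[of "{..<m}" i "\<lambda>i. \<bar>Poly_Mapping.lookup x i\<bar>"] 
  by (simp add: l2norm_L2_set L2_set_def)

text \<open>Coordinate vectors have length 1 and an entry is at most the Euclidean norm, so each
  matrix entry of the projection is 1-Lipschitz for the gap metric.\<close>

lemma lookup_orth_proj_measurable:
  assumes "i < m" "j < m"
  shows "(\<lambda>Y. Poly_Mapping.lookup (orth_proj m Y (Poly_Mapping.single i 1)) j)
    \<in> borel_measurable (grassmannian_borel m n)"
proof (rule lipschitz_borel_measurable_grassmannian)
  fix Y Z assume YZ: "Y \<in> grassmannian m n" "Z \<in> grassmannian m n"
  have "Poly_Mapping.single i 1 \<in> unit_vectors m" using assms by (simp add: unit_vectors_def)
  then have e: "Poly_Mapping.single i 1 \<in> rvec m"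
      "dotp m (Poly_Mapping.single i 1) (Poly_Mapping.single i 1) = 1"
    using orthonormal_unit_vectors[of m] by (auto simp: orthonormal_def)
  let ?e = "Poly_Mapping.single i (1::real)"
  have "\<bar>Poly_Mapping.lookup (orth_proj m Y ?e - orth_proj m Z ?e) j\<bar>
      \<le> l2norm m (orth_proj m Y ?e - orth_proj m Z ?e)" using assms by (intro abs_lookup_le_l2norm)
  also have "\<dots> \<le> gap m Y Z" using YZ e by (intro gap_upper) (auto simp: l2norm_def)
  finally show "\<bar>Poly_Mapping.lookup (orth_proj m Y ?e) j - Poly_Mapping.lookup (orth_proj m Z ?e) j\<bar> \<le> gap m Y Z"
    by (simp add: lookup_minus)
qed

text \<open>Exhibits the squared length of the projection as a polynomial in the entries of
  \<open>g\<close> and of the projection matrix, which gives joint measurability in the subspace and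
  the vector.\<close>

lemma dotp_orth_proj_vec_of:
  assumes "subspace Y" "Y \<subseteq> rvec m"
  shows "dotp m (orth_proj m Y (vec_of m g)) (orth_proj m Y (vec_of m g)) =
    (\<Sum>j<m. (\<Sum>i<m. g i * Poly_Mapping.lookup (orth_proj m Y (Poly_Mapping.single i 1)) j) * g j)"
proof -
  interpret linear "orth_proj m Y" by (rule linear_orth_proj[OF assms])
  have "orth_proj m Y (vec_of m g) = (\<Sum>i<m. g i *\<^sub>R orth_proj m Y (Poly_Mapping.single i 1))"
    by (simp add: vec_of_def sum scale)
  then show ?thesis
    unfolding dotp_orth_proj_self[OF assms]
    by (simp add: dotp_commute[of m _ "vec_of m g"] dotp_vec_of lookup_sum)
qed

section \<open>Householder reflections and their action on the Grassmannian\<close>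

definition reflection :: "nat \<Rightarrow> rseq \<Rightarrow> rseq \<Rightarrow> rseq" where
  "reflection m e v = v - (2 * dotp m v e / dotp m e e) *\<^sub>R e"

context
  fixes m :: nat and e :: rseq
  assumes e: "e \<in> rvec m" "e \<noteq> 0"
begin

lemma dotp_self_nonzero: "dotp m e e \<noteq> 0"
  using dotp_eq_0 e by blast

lemma dotp_reflection: "dotp m (reflection m e x) (reflection m e y) = dotp m x y"
proof -
  define d where "d = dotp m e e"
  have "d \<noteq> 0" using dotp_self_nonzero by (simp add: d_def)
  then have "dotp m x y - 2 * u / d * v - 2 * v / d * (u - 2 * u / d * d) = dotp m x y" for u v
    by simp
  from this[of "dotp m x e" "dotp m y e"] show ?thesis
    unfolding reflection_def
    by (simp add: dotp_simps dotp_commute[of m e x] dotp_commute[of m e y] d_def[symmetric] algebra_simps)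
qed

lemma reflection_reflection: "reflection m e (reflection m e x) = x"
proof -
  have "dotp m (reflection m e x) e = - dotp m x e"
    using dotp_self_nonzero by (simp add: reflection_def dotp_simps)
  then show ?thesis by (simp add: reflection_def[of m e "reflection m e x"]) (simp add: reflection_def)
qed

lemma linear_reflection: "linear (reflection m e)"
  by (rule linearI) (auto simp: reflection_def dotp_simps algebra_simps add_divide_distrib scaleR_left_distrib)

lemma reflection_in_rvec: "x \<in> rvec m \<Longrightarrow> reflection m e x \<in> rvec m"
  using e subspace_rvec by (auto simp: reflection_def intro!: subspace_diff subspace_scale)

lemma reflection_in_rotations: "reflection m e \<in> rotations m"
  using linear_reflection reflection_in_rvec dotp_reflection by (auto simp: rotations_def)

lemma inj_reflection: "inj (reflection m e)"
  by (metis injI reflection_reflection)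

text \<open>An isometry maps an orthonormal basis of \<open>Y\<close> to an orthonormal basis of the
  image, so the dimension is kept.\<close>

lemma reflection_image_grassmannian:
  assumes "Y \<in> grassmannian m n"
  shows "reflection m e ` Y \<in> grassmannian m n"
proof -
  note Y = grassmannianD[OF assms]
  obtain E where E: "orthonormal m E" "span E = Y" using orthonormal_basis_exists[OF Y(1,2)] by blast
  have "orthonormal m (reflection m e ` E)"
    using E(1) reflection_in_rvec by (auto simp: orthonormal_def dotp_reflection inj_eq[OF inj_reflection])
  moreover have "span (reflection m e ` E) = reflection m e ` Y"
    by (simp add: linear_span_image[OF linear_reflection] E(2))
  ultimately have "dim (reflection m e ` Y) = card (reflection m e ` E)"
    using orthonormal_card by metis
  also have "\<dots> = n"
    using card_image[OF inj_on_subset[OF inj_reflection]] orthonormal_card[OF E] Y(3) by simp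
  finally show ?thesis
    using Y linear_subspace_image[OF linear_reflection] reflection_in_rvec by (auto simp: grassmannian_def)
qed

text \<open>The isometry preserves the orthogonality that characterises the projection; the
  projection onto the image of \<open>Y\<close> is thus a conjugate of the projection onto
  \<open>Y\<close>.\<close>

lemma orth_proj_reflection:
  assumes "Y \<in> grassmannian m n"
  shows "orth_proj m (reflection m e ` Y) (reflection m e x) = reflection m e (orth_proj m Y x)"
proof (rule orth_proj_eq)
  note Y = grassmannianD[OF assms]
  show "subspace (reflection m e ` Y)" "reflection m e ` Y \<subseteq> rvec m"
    using grassmannianD[OF reflection_image_grassmannian[OF assms]] by auto
  show "reflection m e (orth_proj m Y x) \<in> reflection m e ` Y"
    using orth_proj(1)[OF Y(1,2)] by blast
  show "dotp m (reflection m e x - reflection m e (orth_proj m Y x)) z = 0"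
    if "z \<in> reflection m e ` Y" for z
    using that orth_proj(2)[OF Y(1,2)]
    by (auto simp: linear_diff[OF linear_reflection, symmetric] dotp_reflection)
qed

text \<open>Substituting \<open>x = reflection m e u\<close> conjugates both projections by the same
  isometry, which maps the unit ball to itself.\<close>

lemma gap_reflection_le:
  assumes "Y \<in> grassmannian m n" "Z \<in> grassmannian m n"
  shows "gap m (reflection m e ` Y) (reflection m e ` Z) \<le> gap m Y Z"
proof (rule gap_least)
  fix x assume x: "x \<in> rvec m" "l2norm m x \<le> 1"
  define u where "u = reflection m e x"
  have xu: "x = reflection m e u" by (simp add: u_def reflection_reflection)
  have "l2norm m (orth_proj m (reflection m e ` Y) x - orth_proj m (reflection m e ` Z) x)
      = l2norm m (reflection m e (orth_proj m Y u - orth_proj m Z u))"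
    unfolding xu orth_proj_reflection[OF assms(1)] orth_proj_reflection[OF assms(2)]
    by (simp add: linear_diff[OF linear_reflection])
  also have "\<dots> = l2norm m (orth_proj m Y u - orth_proj m Z u)"
    by (simp add: l2norm_def dotp_reflection)
  also have "\<dots> \<le> gap m Y Z"
    using x by (intro gap_upper[OF assms])
      (auto simp: u_def reflection_in_rvec l2norm_def dotp_reflection)
  finally show "l2norm m (orth_proj m (reflection m e ` Y) x - orth_proj m (reflection m e ` Z) x) \<le> gap m Y Z" .
qed (rule gap_nonneg)

text \<open>The action is 1-Lipschitz for the gap metric, so preimages of open sets are open.
  Without measurability the invariance of \<open>distr\<close> would say nothing about the measures
  of preimages.\<close>

lemma image_reflection_measurable:
  "(`) (reflection m e) \<in> grassmannian_borel m n \<rightarrow>\<^sub>M grassmannian_borel m n"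
proof (rule measurable_sigma_sets[OF sets_grassmannian_borel])
  show "{A. openin (Metric_space.mtopology (grassmannian m n) (gap m)) A} \<subseteq> Pow (grassmannian m n)"
    by (auto simp: openin_grassmannian)
  show "(`) (reflection m e) \<in> space (grassmannian_borel m n) \<rightarrow> grassmannian m n"
    by (auto simp: space_grassmannian_borel reflection_image_grassmannian)
  fix A assume "A \<in> {A. openin (Metric_space.mtopology (grassmannian m n) (gap m)) A}"
  then have A: "\<And>Y. Y \<in> A \<Longrightarrow> \<exists>d>0. \<forall>Z\<in>grassmannian m n. gap m Y Z < d \<longrightarrow> Z \<in> A"
    by (simp add: openin_grassmannian)
  show "(`) (reflection m e) -` A \<inter> space (grassmannian_borel m n) \<in> sets (grassmannian_borel m n)"
    unfolding space_grassmannian_borel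
  proof (rule open_in_sets_grassmannian_borel)
    fix Y assume Y: "Y \<in> (`) (reflection m e) -` A \<inter> grassmannian m n"
    then obtain d where "d > 0" "\<And>Z. Z \<in> grassmannian m n \<Longrightarrow> gap m (reflection m e ` Y) Z < d \<Longrightarrow> Z \<in> A"
      using A by blast
    then show "\<exists>d>0. \<forall>Z\<in>grassmannian m n. gap m Y Z < d \<longrightarrow> Z \<in> (`) (reflection m e) -` A \<inter> grassmannian m n"
      using Y gap_reflection_le reflection_image_grassmannian
      by (intro exI[of _ d]) (force intro: le_less_trans)
  qed simp
qed

end

section \<open>Projections of a fixed vector onto a random subspace\<close>

text \<open>Leaving the signs of \<open>s\<close> and \<open>t\<close> free covers both tails: for
  \<open>s > 0\<close> the projection is too long, for \<open>s < 0\<close> it is too short. The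
  form \<open>s * _ - t * _ \<ge> 0\<close> is the exponent of Chernoff's bound.\<close>

definition proj_event :: "nat \<Rightarrow> nat \<Rightarrow> real \<Rightarrow> real \<Rightarrow> rseq \<Rightarrow> rseq set set" where
  "proj_event m n s t x = {Y \<in> grassmannian m n.
     t * dotp m x x \<le> s * dotp m (orth_proj m Y x) (orth_proj m Y x)}"

lemma vec_of_lookup: "x \<in> rvec m \<Longrightarrow> vec_of m (Poly_Mapping.lookup x) = x"
  by (rule poly_mapping_eqI) (auto simp: lookup_vec_of rvec_def in_keys_iff subset_iff)

lemma proj_event_joint_measurable:
  "{(Y, g) \<in> space (grassmannian_borel m n \<Otimes>\<^sub>M gauss_prod {..<m}). Y \<in> proj_event m n s t (vec_of m g)}
     \<in> sets (grassmannian_borel m n \<Otimes>\<^sub>M gauss_prod {..<m})"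
proof -
  have "{(Y, g) \<in> space (grassmannian_borel m n \<Otimes>\<^sub>M gauss_prod {..<m}). Y \<in> proj_event m n s t (vec_of m g)}
     = {p \<in> space (grassmannian_borel m n \<Otimes>\<^sub>M gauss_prod {..<m}). t * (\<Sum>i<m. (snd p i)\<^sup>2) \<le> s *
        (\<Sum>j<m. (\<Sum>i<m. snd p i * Poly_Mapping.lookup (orth_proj m (fst p) (Poly_Mapping.single i 1)) j) * snd p j)}"
    by (auto simp: proj_event_def dotp_vec_of_self dotp_orth_proj_vec_of grassmannianD
        space_pair_measure space_grassmannian_borel)
  also have "\<dots> \<in> sets (grassmannian_borel m n \<Otimes>\<^sub>M gauss_prod {..<m})"
  proof -
    let ?M = "grassmannian_borel m n \<Otimes>\<^sub>M gauss_prod {..<m}"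
    have g: "(\<lambda>p. snd p i) \<in> borel_measurable ?M" if "i < m" for i
      using that measurable_compose[OF measurable_snd measurable_gauss_prod_component[of i "{..<m}"]] by simp
    have P: "(\<lambda>p. Poly_Mapping.lookup (orth_proj m (fst p) (Poly_Mapping.single i 1)) j) \<in> borel_measurable ?M"
      if "i < m" "j < m" for i j
      by (rule measurable_compose[OF measurable_fst lookup_orth_proj_measurable[OF that]])
    have "(\<lambda>p. t * (\<Sum>i<m. (snd p i)\<^sup>2)) \<in> borel_measurable ?M"
      using g by (intro borel_measurable_times borel_measurable_sum borel_measurable_power) auto
    moreover have "(\<lambda>p. s * (\<Sum>j<m. (\<Sum>i<m. snd p i *
        Poly_Mapping.lookup (orth_proj m (fst p) (Poly_Mapping.single i 1)) j) * snd p j)) \<in> borel_measurable ?M"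
    proof (rule borel_measurable_times[OF borel_measurable_const borel_measurable_sum])
      fix j assume "j \<in> {..<m}"
      then have j: "j < m" by simp
      show "(\<lambda>p. (\<Sum>i<m. snd p i *
        Poly_Mapping.lookup (orth_proj m (fst p) (Poly_Mapping.single i 1)) j) * snd p j) \<in> borel_measurable ?M"
      proof (rule borel_measurable_times[OF borel_measurable_sum g[OF j]])
        fix i assume "i \<in> {..<m}"
        then have i: "i < m" by simp
        show "(\<lambda>p. snd p i * Poly_Mapping.lookup (orth_proj m (fst p) (Poly_Mapping.single i 1)) j)
            \<in> borel_measurable ?M"
          by (rule borel_measurable_times[OF g[OF i] P[OF i j]])
      qed
    qed
    ultimately show ?thesis by (rule borel_measurable_le)
  qed
  finally show ?thesis .
qed

lemma proj_event_measurable: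
  assumes "x \<in> rvec m"
  shows "proj_event m n s t x \<in> sets (grassmannian_borel m n)"
proof -
  \<comment> \<open>The event for a fixed vector is a section of the joint event. The restriction is
    there because points of the product space are extensional.\<close>
  let ?g = "restrict (Poly_Mapping.lookup x) {..<m}"
  have g: "?g \<in> space (gauss_prod {..<m})" by (simp add: space_PiM)
  have "vec_of m ?g = vec_of m (Poly_Mapping.lookup x)" by (simp add: vec_of_def)
  then have "vec_of m ?g = x" using assms by (simp add: vec_of_lookup)
  moreover have "(\<lambda>Y. (Y, ?g)) \<in> grassmannian_borel m n \<rightarrow>\<^sub>M grassmannian_borel m n \<Otimes>\<^sub>M gauss_prod {..<m}"
    using g by simp
  ultimately have "proj_event m n s t x = (\<lambda>Y. (Y, ?g)) -` {(Y, g) \<in> space (grassmannian_borel m n \<Otimes>\<^sub>M gauss_prod {..<m}).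
       Y \<in> proj_event m n s t (vec_of m g)} \<inter> space (grassmannian_borel m n)"
    using g by (auto simp: proj_event_def space_pair_measure space_grassmannian_borel)
  then show ?thesis
    using measurable_sets[OF \<open>(\<lambda>Y. (Y, ?g)) \<in> _\<close> proj_event_joint_measurable] by simp
qed

lemma proj_event_scaleR:
  assumes "a \<noteq> 0"
  shows "proj_event m n s t (a *\<^sub>R x) = proj_event m n s t x"
proof -
  have "t * (a * (a * u)) \<le> s * (a * (a * v)) \<longleftrightarrow> t * u \<le> s * v" for u v
  proof -
    have "t * (a * (a * u)) \<le> s * (a * (a * v)) \<longleftrightarrow> a\<^sup>2 * (t * u) \<le> a\<^sup>2 * (s * v)"
      by (simp add: power2_eq_square mult_ac)
    also have "\<dots> \<longleftrightarrow> t * u \<le> s * v" using assms by (subst mult_le_cancel_left_pos) auto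
    finally show ?thesis .
  qed
  then show ?thesis
    by (auto simp: proj_event_def orth_proj_scaleR dotp_simps grassmannianD)
qed

lemma haar_grassmannianD:
  assumes "is_haar_grassmannian m n \<mu>"
  shows "prob_space \<mu>" "space \<mu> = grassmannian m n" "sets \<mu> = sets (grassmannian_borel m n)"
    "U \<in> rotations m \<Longrightarrow> distr \<mu> \<mu> ((`) U) = \<mu>"
  using assms by (auto simp: is_haar_grassmannian_def)

text \<open>After scaling \<open>z\<close> to the length of \<open>x\<close>, which does not affect
  the event, a single reflection takes one vector to the other; invariance under it transfers the
  measure.\<close>

lemma haar_proj_event_eq:
  assumes \<mu>: "is_haar_grassmannian m n \<mu>" and x: "x \<in> rvec m" "x \<noteq> 0" and z: "z \<in> rvec m" "z \<noteq> 0"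
  shows "emeasure \<mu> (proj_event m n s t x) = emeasure \<mu> (proj_event m n s t z)"
proof -
  define a where "a = l2norm m x / l2norm m z"
  define w where "w = a *\<^sub>R z"
  have pos: "dotp m x x > 0" "dotp m z z > 0"
    using dotp_eq_0 dotp_nonneg x z by (metis order_le_less)+
  then have a: "a \<noteq> 0" by (simp add: a_def l2norm_def)
  have w: "w \<in> rvec m" using z subspace_rvec by (simp add: w_def subspace_scale)
  have "dotp m w w = a\<^sup>2 * dotp m z z" by (simp add: w_def dotp_simps power2_eq_square)
  also have "\<dots> = dotp m x x" using pos by (simp add: a_def power_divide l2norm_power2)
  finally have xw: "dotp m w w = dotp m x x" .
  have "emeasure \<mu> (proj_event m n s t x) = emeasure \<mu> (proj_event m n s t w)"
  proof (cases "x = w")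
    case False
    define e where "e = x - w"
    have e: "e \<in> rvec m" "e \<noteq> 0" using x w False subspace_rvec by (auto simp: e_def subspace_diff)
    let ?U = "reflection m e"
    \<comment> \<open>Equal lengths make the coefficient in the reflection along
      \<open>x - w\<close> equal to 1, so that it sends \<open>x\<close> to
      \<open>x - (x - w) = w\<close>.\<close>
    have "dotp m e e = 2 * dotp m x e"
      using xw by (simp add: e_def dotp_simps dotp_commute[of m w x])
    then have "2 * dotp m x e / dotp m e e = 1" using dotp_self_nonzero[OF e] by simp
    then have Ux: "?U x = w" by (simp add: reflection_def e_def)
    have "emeasure \<mu> (proj_event m n s t w) = emeasure (distr \<mu> \<mu> ((`) ?U)) (proj_event m n s t w)"
      using haar_grassmannianD(4)[OF \<mu> reflection_in_rotations[OF e]] by simp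
    also have "\<dots> = emeasure \<mu> ((`) ?U -` proj_event m n s t w \<inter> space \<mu>)"
      using image_reflection_measurable[OF e, of n] proj_event_measurable[OF w]
      by (intro emeasure_distr)
        (simp_all add: haar_grassmannianD[OF \<mu>] measurable_cong_sets[OF haar_grassmannianD(3)[OF \<mu>] haar_grassmannianD(3)[OF \<mu>]])
    also have "(`) ?U -` proj_event m n s t w \<inter> space \<mu> = proj_event m n s t x"
      using reflection_image_grassmannian[OF e] 
      by (auto simp: haar_grassmannianD(2)[OF \<mu>] proj_event_def Ux[symmetric] orth_proj_reflection[OF e]
          dotp_reflection[OF e])
    finally show ?thesis ..
  qed simp
  then show ?thesis using proj_event_scaleR[OF a] by (simp add: w_def)
qed

text \<open>By invariance \<open>x\<close> may be replaced by any other vector, hence by a Gaussian one; then the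
  subspace may be fixed.\<close>

lemma haar_proj_event_le:
  assumes \<mu>: "is_haar_grassmannian m n \<mu>" and x: "x \<in> rvec m" "x \<noteq> 0"
    and p: "\<And>Y. Y \<in> grassmannian m n \<Longrightarrow> (\<integral>\<^sup>+g. ennreal (exp ((s * dotp m (orth_proj m Y (vec_of m g)) (orth_proj m Y (vec_of m g))
       - t * dotp m (vec_of m g) (vec_of m g)) / 2)) \<partial>gauss_prod {..<m}) \<le> ennreal p"
    and "0 \<le> p"
  shows "measure \<mu> (proj_event m n s t x) \<le> p"
proof -
  interpret prob_space \<mu> by (rule haar_grassmannianD(1)[OF \<mu>])
  note s\<mu> = haar_grassmannianD(2)[OF \<mu>] haar_grassmannianD(3)[OF \<mu>]
  let ?G = "gauss_prod {..<m}"
  interpret G: prob_space ?G by (rule prob_space_gauss_prod)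
  interpret pair_sigma_finite \<mu> ?G by (simp add: pair_sigma_finite_def sigma_finite_measure_axioms G.sigma_finite_measure_axioms)
  let ?I = "\<lambda>Y g. indicator (proj_event m n s t (vec_of m g)) Y :: ennreal"
  have sets_eq: "sets (\<mu> \<Otimes>\<^sub>M ?G) = sets (grassmannian_borel m n \<Otimes>\<^sub>M ?G)"
    by (intro sets_pair_measure_cong s\<mu> refl)
  have space_eq: "space (\<mu> \<Otimes>\<^sub>M ?G) = space (grassmannian_borel m n \<Otimes>\<^sub>M ?G)"
    using sets_eq by (rule sets_eq_imp_space_eq)
  have "(\<lambda>p. indicator {(Y, g) \<in> space (\<mu> \<Otimes>\<^sub>M ?G). Y \<in> proj_event m n s t (vec_of m g)} p :: ennreal)
      \<in> borel_measurable (\<mu> \<Otimes>\<^sub>M ?G)"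
    using proj_event_joint_measurable[of m n s t] by (intro borel_measurable_indicator) (simp only: sets_eq space_eq)
  then have meas: "(\<lambda>(Y, g). ?I Y g) \<in> borel_measurable (\<mu> \<Otimes>\<^sub>M ?G)"
    by (rule measurable_cong[THEN iffD1, rotated]) (auto simp: indicator_def)
  \<comment> \<open>For the zero vector both sides of the defining inequality vanish and the event
    is the whole space. The inequality therefore holds for every \<open>g\<close>, with no need to
    discard a null set.\<close>
  have le: "emeasure \<mu> (proj_event m n s t x) \<le> emeasure \<mu> (proj_event m n s t (vec_of m g))" for g
  proof (cases "vec_of m g = 0")
    case True
    have "orth_proj m Y 0 = 0" if "Y \<in> grassmannian m n" for Y
      using linear_0[OF linear_orth_proj] grassmannianD[OF that] by blast
    then have "proj_event m n s t (vec_of m g) = space \<mu>"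
      by (auto simp: proj_event_def True dotp_simps s\<mu>)
    then show ?thesis using emeasure_space by metis
  next
    case False
    then show ?thesis using haar_proj_event_eq[OF \<mu> x vec_of_in_rvec] by simp
  qed
  have "emeasure \<mu> (proj_event m n s t x) = (\<integral>\<^sup>+g. emeasure \<mu> (proj_event m n s t x) \<partial>?G)"
    by (simp add: G.emeasure_space_1)
  also have "\<dots> \<le> (\<integral>\<^sup>+g. emeasure \<mu> (proj_event m n s t (vec_of m g)) \<partial>?G)"
    by (intro nn_integral_mono le)
  also have "\<dots> = (\<integral>\<^sup>+g. \<integral>\<^sup>+Y. ?I Y g \<partial>\<mu> \<partial>?G)"
    using proj_event_measurable[OF vec_of_in_rvec] by (simp add: s\<mu>)
  also have "\<dots> = (\<integral>\<^sup>+Y. \<integral>\<^sup>+g. ?I Y g \<partial>?G \<partial>\<mu>)"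
    by (rule Fubini'[OF meas])
  also have "\<dots> \<le> (\<integral>\<^sup>+Y. ennreal p \<partial>\<mu>)"
  proof (rule nn_integral_mono)
    fix Y assume "Y \<in> space \<mu>"
    then have "Y \<in> grassmannian m n" by (simp add: s\<mu>)
    \<comment> \<open>Exponential Markov bound: on the event the exponent is nonnegative, so the
      indicator is at most the exponential.\<close>
    then have "(\<integral>\<^sup>+g. ?I Y g \<partial>?G) \<le> (\<integral>\<^sup>+g. ennreal (exp ((s * dotp m (orth_proj m Y (vec_of m g)) (orth_proj m Y (vec_of m g))
       - t * dotp m (vec_of m g) (vec_of m g)) / 2)) \<partial>?G)"
      by (intro nn_integral_mono) (auto simp: indicator_def proj_event_def)
    also have "\<dots> \<le> p" by (rule p) fact
    finally show "(\<integral>\<^sup>+g. ?I Y g \<partial>?G) \<le> p" .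
  qed
  also have "\<dots> = p" by (simp add: emeasure_space_1)
  finally show ?thesis using \<open>0 \<le> p\<close> by (simp add: emeasure_eq_measure)
qed

text \<open>The squared length of the projection is the sum over an orthonormal basis of
  \<open>Y\<close>, so the quadratic Gaussian integral applies with \<open>n\<close> basis
  vectors.\<close>

lemma haar_proj_large:
  assumes \<mu>: "is_haar_grassmannian m n \<mu>" and x: "x \<in> rvec m" "x \<noteq> 0" and st: "0 \<le> s" "s < 1 + t"
  shows "measure \<mu> (proj_event m n s t x)
    \<le> (1 + t) powr (- real m / 2) * (1 - s / (1 + t)) powr (- real n / 2)"
proof (rule haar_proj_event_le[OF \<mu> x])
  fix Y assume Y: "Y \<in> grassmannian m n"
  obtain E D where ED: "orthonormal m E" "orthonormal m D" "span E = Y" "card E = n" "card D = m - n"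
    "\<And>x. x \<in> rvec m \<Longrightarrow> dotp m x x = (\<Sum>a\<in>E. (dotp m x a)\<^sup>2) + (\<Sum>a\<in>D. (dotp m x a)\<^sup>2)"
    using grassmannian_orthonormal_bases[OF Y] by metis
  show "(\<integral>\<^sup>+g. ennreal (exp ((s * dotp m (orth_proj m Y (vec_of m g)) (orth_proj m Y (vec_of m g))
       - t * dotp m (vec_of m g) (vec_of m g)) / 2)) \<partial>gauss_prod {..<m})
     \<le> ennreal ((1 + t) powr (- real m / 2) * (1 - s / (1 + t)) powr (- real n / 2))"
    using nn_integral_gauss_quadratic[OF ED(1) st] dotp_orth_proj_orthonormal[OF ED(1)]
    by (simp add: ED(3,4) diff_divide_distrib)
qed simp

text \<open>By Pythagoras the exponent equals \<open>s\<close> times the squared distance to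
  \<open>Y\<close> minus \<open>t\<close> times the squared length. The quadratic Gaussian integral
  is then applied to a basis of the orthogonal complement, with \<open>m - n\<close>
  vectors.\<close>

lemma haar_proj_small:
  assumes \<mu>: "is_haar_grassmannian m n \<mu>" and x: "x \<in> rvec m" "x \<noteq> 0" and st: "0 \<le> s" "s < 1 + t"
  shows "measure \<mu> (proj_event m n (- s) (t - s) x)
    \<le> (1 + t) powr (- real m / 2) * (1 - s / (1 + t)) powr (- real (m - n) / 2)"
proof (rule haar_proj_event_le[OF \<mu> x])
  fix Y assume Y: "Y \<in> grassmannian m n"
  obtain E D where ED: "orthonormal m E" "orthonormal m D" "span E = Y" "card E = n" "card D = m - n"
    "\<And>x. x \<in> rvec m \<Longrightarrow> dotp m x x = (\<Sum>a\<in>E. (dotp m x a)\<^sup>2) + (\<Sum>a\<in>D. (dotp m x a)\<^sup>2)"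
    using grassmannian_orthonormal_bases[OF Y] by metis
  have eq: "(- s * dotp m (orth_proj m Y x) (orth_proj m Y x) - (t - s) * dotp m x x) / 2
      = s * (\<Sum>a\<in>D. (dotp m x a)\<^sup>2) / 2 - t * dotp m x x / 2" if "x \<in> rvec m" for x
    unfolding dotp_orth_proj_orthonormal[OF ED(1), unfolded ED(3)] using ED(6)[OF that]
    by (simp add: algebra_simps add_divide_distrib diff_divide_distrib)
  show "(\<integral>\<^sup>+g. ennreal (exp ((- s * dotp m (orth_proj m Y (vec_of m g)) (orth_proj m Y (vec_of m g))
       - (t - s) * dotp m (vec_of m g) (vec_of m g)) / 2)) \<partial>gauss_prod {..<m})
     \<le> ennreal ((1 + t) powr (- real m / 2) * (1 - s / (1 + t)) powr (- real (m - n) / 2))"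
    unfolding eq[OF vec_of_in_rvec] nn_integral_gauss_quadratic[OF ED(2) st] ED(5) ..
qed simp

text \<open>Both tails of the squared distance to \<open>Y\<close>, whose mean is
  \<open>real R / real m\<close> times the squared length of \<open>x\<close>. Constant factors on
  either side of the mean suffice later, and the price is only a rate linear in
  \<open>R\<close>.\<close>

lemma haar_concentration:
  fixes \<beta> \<beta>' :: real
  assumes \<mu>: "is_haar_grassmannian m n \<mu>" and m: "m = n + R" "n > 0" and x: "x \<in> rvec m" "x \<noteq> 0"
    and \<beta>: "\<beta> = real R / (16 * real m)" "\<beta>' = 8 * real R / real m"
  obtains B where "B \<in> sets \<mu>" "measure \<mu> B \<le> 2 * exp (- real R / 4)"
    "\<And>Y. Y \<in> grassmannian m n \<Longrightarrow> Y \<notin> B \<Longrightarrow>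
       \<beta> * dotp m x x \<le> dotp m x x - dotp m (orth_proj m Y x) (orth_proj m Y x)"
    "\<And>Y. Y \<in> grassmannian m n \<Longrightarrow> Y \<notin> B \<Longrightarrow>
       dotp m x x - dotp m (orth_proj m Y x) (orth_proj m Y x) \<le> \<beta>' * dotp m x x"
proof -
  interpret prob_space \<mu> by (rule haar_grassmannianD(1)[OF \<mu>])
  have meas: "proj_event m n s t x \<in> sets \<mu>" for s t
    using proj_event_measurable[OF x(1)] haar_grassmannianD(3)[OF \<mu>] by simp
  have m0: "real m > 0" using m by simp
  have Rm: "real R \<le> real m" using m by simp
  \<comment> \<open>\<open>B1\<close> is the event that the squared distance is at most \<beta>
    times the squared length, with Chernoff parameter \<open>s = 4\<close>. \<open>B2\<close> says
    that it is at least \<open>\<beta>'\<close> times it, with \<open>s = 1/2\<close>; for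
    \<open>\<beta>' > 1\<close> the upper estimate is trivial, so nothing is excluded.\<close>
  define B1 where "B1 = proj_event m n 4 (4 * (1 - \<beta>)) x"
  define B2 where "B2 = (if \<beta>' \<le> 1 then proj_event m n (- (1/2)) (\<beta>' / 2 - 1/2) x else {})"
  have powr_exp: "a powr (- real N / 2) \<le> exp (- c * real N / 2)" if "exp c \<le> a" for a c :: real and N :: nat
  proof -
    have "exp c powr (- real N / 2) = exp (- c * real N / 2)" by (simp add: powr_def)
    moreover have "a powr (- real N / 2) \<le> exp c powr (- real N / 2)"
      using that by (intro powr_mono2') auto
    ultimately show ?thesis by simp
  qed
  have \<beta>01: "0 \<le> \<beta>" "\<beta> \<le> 1/16" using Rm m0 by (auto simp: \<beta> field_simps)
  have b1: "measure \<mu> B1 \<le> exp (- real R / 4)"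
  proof -
    define t where "t = 4 * (1 - \<beta>)"
    have t: "t > 3" "4 < 1 + t" "exp 1 \<le> 1 + t" using \<beta>01 exp_le by (auto simp: t_def)
    have "measure \<mu> B1 \<le> (1 + t) powr (- real m / 2) * (1 - 4 / (1 + t)) powr (- real n / 2)"
      unfolding B1_def t_def[symmetric] using t by (intro haar_proj_large[OF \<mu> x]) auto
    \<comment> \<open>Splitting off the powers of \<open>1 + t\<close> leaves the exponent
      \<open>- real R / 2\<close> on \<open>1 + t = 5 - 4 * \<beta>\<close>, which is at least
      \<open>exp 1\<close>. The other factor costs at most
      \<open>exp (4 * \<beta> * real n) \<le> exp (real R / 4)\<close>.\<close>
    also have "1 - 4 / (1 + t) = (1 - 4 * \<beta>) / (1 + t)" using t by (simp add: t_def field_simps)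
    also have "((1 - 4 * \<beta>) / (1 + t)) powr (- real n / 2)
        = (1 - 4 * \<beta>) powr (- real n / 2) / (1 + t) powr (- real n / 2)"
      by (rule powr_divide)
    also have "(1 + t) powr (- real m / 2) * \<dots>
        = (1 + t) powr (- real m / 2 - (- real n / 2)) * (1 - 4 * \<beta>) powr (- real n / 2)"
      unfolding powr_diff by (simp only: times_divide_eq_right times_divide_eq_left)
    also have "- real m / 2 - (- real n / 2) = - real R / 2" using m by (simp add: field_simps)
    also have "(1 + t) powr (- real R / 2) * (1 - 4 * \<beta>) powr (- real n / 2)
        \<le> exp (- 1 * real R / 2) * exp (- (- 8 * \<beta>) * real n / 2)"
    proof (intro mult_mono powr_exp)
      have "1 / (1 - 4 * \<beta>) \<le> 1 + 8 * \<beta>" 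
      proof -
        have "\<beta> * \<beta> \<le> \<beta> * (1/16)" using \<beta>01 by (intro mult_left_mono) auto
        then have "1 \<le> (1 + 8 * \<beta>) * (1 - 4 * \<beta>)" using \<beta>01 by (simp add: algebra_simps)
        then show ?thesis using \<beta>01 by (simp add: divide_le_eq)
      qed
      also have "\<dots> \<le> exp (8 * \<beta>)" by (rule exp_ge_add_one_self)
      finally have "1 / exp (8 * \<beta>) \<le> 1 - 4 * \<beta>" using \<beta>01 by (simp add: field_simps)
      then show "exp (- 8 * \<beta>) \<le> 1 - 4 * \<beta>" by (simp add: exp_minus inverse_eq_divide)
    qed (use t in auto)
    also have "\<dots> = exp (- real R / 2 + 4 * \<beta> * real n)" by (simp add: mult_exp_exp)
    also have "\<dots> \<le> exp (- real R / 4)"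
    proof -
      have "4 * \<beta> * real n \<le> 4 * \<beta> * real m" using \<beta>01 m by (intro mult_left_mono) auto
      also have "\<dots> = real R / 4" using m0 by (simp add: \<beta>)
      finally show ?thesis by simp
    qed
    finally show ?thesis .
  qed
  have b2: "measure \<mu> B2 \<le> exp (- real R / 4)"
  proof (cases "\<beta>' \<le> 1")
    case True
    have \<beta>'0: "0 \<le> \<beta>'" by (simp add: \<beta>)
    define t where "t = \<beta>' / 2"
    have t: "0 \<le> t" "t \<le> 1/2" "m - n = R" using \<beta>'0 True m by (auto simp: t_def)
    have "measure \<mu> B2 \<le> (1 + t) powr (- real m / 2) * (1 - (1/2) / (1 + t)) powr (- real R / 2)"
      using haar_proj_small[OF \<mu> x, of "1/2" t] t True by (simp add: B2_def t_def)
    \<comment> \<open>The choice of \<open>\<beta>'\<close> makes the first factor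
      \<open>exp (- real R)\<close>, which beats the second factor
      \<open>exp (real R / 2)\<close>.\<close>
    also have "\<dots> \<le> exp (- (\<beta>' / 4) * real m / 2) * exp (- (- 1) * real R / 2)"
    proof (intro mult_mono powr_exp)
      have "t\<^sup>2 \<le> t" using t by (simp add: power2_eq_square mult_left_le_one_le)
      have "exp (\<beta>' / 4) = exp (t / 2)" by (simp add: t_def)
      also have "\<dots> \<le> 1 + t / 2 + (t / 2)\<^sup>2" using t by (intro exp_bound) auto
      also have "\<dots> \<le> 1 + t" using \<open>t\<^sup>2 \<le> t\<close> t by (simp add: power_divide)
      finally show "exp (\<beta>' / 4) \<le> 1 + t" .
      have "exp (- 1) \<le> 1 / (2::real)" using exp_ge_add_one_self[of "1::real"] by (simp add: exp_minus field_simps)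
      also have "1 / 2 \<le> 1 - (1/2) / (1 + t)" using t by (simp add: field_simps)
      finally show "exp (- 1) \<le> 1 - (1/2) / (1 + t)" .
    qed auto
    also have "\<dots> = exp (- real R + real R / 2)" using m0 by (simp add: mult_exp_exp \<beta>)
    also have "\<dots> \<le> exp (- real R / 4)" by simp
    finally show ?thesis .
  qed (simp add: B2_def)
  show thesis
  proof (rule that[of "B1 \<union> B2"])
    show "B1 \<union> B2 \<in> sets \<mu>" using meas by (auto simp: B1_def B2_def)
    have "measure \<mu> (B1 \<union> B2) \<le> measure \<mu> B1 + measure \<mu> B2"
      using meas by (intro measure_subadditive) (auto simp: B1_def B2_def emeasure_eq_measure)
    then show "measure \<mu> (B1 \<union> B2) \<le> 2 * exp (- real R / 4)" using b1 b2 by simp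
    fix Y assume Y: "Y \<in> grassmannian m n" "Y \<notin> B1 \<union> B2"
    show "\<beta> * dotp m x x \<le> dotp m x x - dotp m (orth_proj m Y x) (orth_proj m Y x)"
      using Y by (simp add: B1_def proj_event_def algebra_simps)
    show "dotp m x x - dotp m (orth_proj m Y x) (orth_proj m Y x) \<le> \<beta>' * dotp m x x"
    proof (cases "\<beta>' \<le> 1")
      case True
      then show ?thesis using Y by (simp add: B2_def proj_event_def field_simps)
    next
      case False
      then have "1 * dotp m x x \<le> \<beta>' * dotp m x x"
        using dotp_nonneg[of m x] by (intro mult_right_mono) auto
      then show ?thesis using dotp_nonneg[of m "orth_proj m Y x"] by simp
    qed
  qed
qed

section \<open>Integer vectors of bounded \<open>\<parallel>\<cdot>\<parallel>\<^sub>1\<close>\<close>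

lemma lookup_rvec_eq_0: "x \<in> rvec m \<Longrightarrow> \<not> i < m \<Longrightarrow> Poly_Mapping.lookup x i = 0"
  by (auto simp: rvec_def in_keys_iff)

lemma sum_int_power_le:
  fixes q :: real
  assumes "0 < q" "q \<le> 1/2"
  shows "(\<Sum>j\<in>{- int L..int L}. q ^ nat \<bar>j\<bar>) \<le> 1 + 4 * q"
proof -
  \<comment> \<open>The subtracted term makes the induction go through: a step adds
    \<open>2 * q ^ Suc L\<close>, half of the reserve, and the other half covers the next reserve
    because \<open>q \<le> 1/2\<close>.\<close>
  have "(\<Sum>j\<in>{- int L..int L}. q ^ nat \<bar>j\<bar>) \<le> 1 + 4 * q - 4 * q ^ Suc L"
  proof (induction L)
    case (Suc L)
    have "{- int (Suc L)..int (Suc L)} = insert (- int (Suc L)) (insert (int (Suc L)) {- int L..int L})"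
      by auto
    then have "(\<Sum>j\<in>{- int (Suc L)..int (Suc L)}. q ^ nat \<bar>j\<bar>)
        = 2 * q ^ Suc L + (\<Sum>j\<in>{- int L..int L}. q ^ nat \<bar>j\<bar>)"
      by (simp add: nat_add_distrib)
    moreover have "q * q ^ Suc L \<le> (1/2) * q ^ Suc L" using assms by (intro mult_right_mono) auto
    ultimately show ?case using Suc.IH by simp
  qed simp
  then show ?thesis using assms by (smt (verit) zero_le_power)
qed

definition int_vectors :: "nat \<Rightarrow> nat \<Rightarrow> rseq set" where
  "int_vectors m L = {k \<in> rvec m. (\<forall>i<m. Poly_Mapping.lookup k i \<in> \<int>) \<and> l1norm m k \<le> real L}"

text \<open>Chernoff-type counting: weighting \<open>k\<close> by \<open>q\<^bsup>\<parallel>k\<parallel>\<^sub>1\<^esup>\<close> handles supports and entries at once.\<close>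

lemma card_int_vectors:
  fixes q :: real
  assumes q: "0 < q" "q \<le> 1/2"
  shows "finite (int_vectors m L)" "real (card (int_vectors m L)) \<le> (1 + 4 * q) ^ m / q ^ L"
proof -
  let ?P = "PiE {..<m} (\<lambda>_. {- int L..int L})"
  \<comment> \<open>On integral entries the floor loses nothing, so this embeds the vectors into a
    finite box of integer tuples.\<close>
  define \<phi> where "\<phi> k = restrict (\<lambda>i. \<lfloor>Poly_Mapping.lookup k i\<rfloor>) {..<m}" for k :: rseq
  have lk: "real_of_int (\<phi> k i) = Poly_Mapping.lookup k i" if "k \<in> int_vectors m L" "i < m" for k i
    using that by (auto simp: int_vectors_def \<phi>_def elim!: Ints_cases)
  have inj: "inj_on \<phi> (int_vectors m L)"
  proof (rule inj_onI, rule poly_mapping_eqI)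
    fix k l i assume kl: "k \<in> int_vectors m L" "l \<in> int_vectors m L" "\<phi> k = \<phi> l"
    show "Poly_Mapping.lookup k i = Poly_Mapping.lookup l i"
    proof (cases "i < m")
      case True
      then show ?thesis using lk[of k i] lk[of l i] kl by simp
    next
      case False
      then show ?thesis using kl(1,2) by (simp add: int_vectors_def lookup_rvec_eq_0[of _ m])
    qed
  qed
  have sum_le: "(\<Sum>i<m. nat \<bar>\<phi> k i\<bar>) \<le> L" if "k \<in> int_vectors m L" for k
  proof -
    have "real (\<Sum>i<m. nat \<bar>\<phi> k i\<bar>) = l1norm m k"
      using lk[OF that] by (simp add: l1norm_def)
    also have "\<dots> \<le> real L" using that by (simp add: int_vectors_def)
    finally show ?thesis by (simp only: of_nat_le_iff)
  qed
  have img: "\<phi> ` int_vectors m L \<subseteq> ?P"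
  proof
    fix x assume "x \<in> \<phi> ` int_vectors m L"
    then obtain k where k: "k \<in> int_vectors m L" "x = \<phi> k" by blast
    have "nat \<bar>\<phi> k i\<bar> \<le> L" if "i < m" for i
      using sum_le[OF k(1)] member_le_sum[of i "{..<m}" "\<lambda>i. nat \<bar>\<phi> k i\<bar>"] that by simp
    then show "x \<in> ?P" using k(2) by (force simp: \<phi>_def)
  qed
  have finP: "finite ?P" by (intro finite_PiE) auto
  show fin: "finite (int_vectors m L)"
    using finite_imageD[OF finite_subset[OF img finP] inj] .
  have "real (card (int_vectors m L)) * q ^ L = (\<Sum>x\<in>\<phi> ` int_vectors m L. q ^ L)"
    by (simp add: card_image[OF inj])
  \<comment> \<open>Every counted tuple has weight at least \<open>q ^ L\<close>. Enlarging the sum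
    to the whole box then lets it factor over the coordinates.\<close>
  also have "\<dots> \<le> (\<Sum>x\<in>\<phi> ` int_vectors m L. \<Prod>i<m. q ^ nat \<bar>x i\<bar>)"
  proof (rule sum_mono)
    fix x assume "x \<in> \<phi> ` int_vectors m L"
    then have "(\<Sum>i<m. nat \<bar>x i\<bar>) \<le> L" using sum_le by blast
    then show "q ^ L \<le> (\<Prod>i<m. q ^ nat \<bar>x i\<bar>)"
      using q by (simp add: power_sum[symmetric] power_decreasing)
  qed
  also have "\<dots> \<le> (\<Sum>x\<in>?P. \<Prod>i<m. q ^ nat \<bar>x i\<bar>)"
    using q by (intro sum_mono2 finP img prod_nonneg) auto
  also have "\<dots> = (\<Prod>i<m. \<Sum>j\<in>{- int L..int L}. q ^ nat \<bar>j\<bar>)"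
    by (rule prod_sum_PiE[symmetric]) auto
  also have "\<dots> \<le> (\<Prod>i<m. 1 + 4 * q)"
    using sum_int_power_le[OF q] q by (intro prod_mono) (auto intro!: sum_nonneg)
  finally show "real (card (int_vectors m L)) \<le> (1 + 4 * q) ^ m / q ^ L"
    using q by (simp add: field_simps)
qed

text \<open>The extreme points of \<open>{w. \<parallel>w\<parallel>\<^sub>\<infinity> \<le> 1, \<parallel>w\<parallel>\<^sub>1 \<le> L}\<close> are integral: a point with two
  fractional coordinates moves along a segment preserving \<open>\<parallel>\<cdot>\<parallel>\<^sub>1\<close> until one of them becomes integral.\<close>

lemma convex_le_of_integral_le:
  fixes f :: "(nat \<Rightarrow> real) \<Rightarrow> real"
  assumes conv: "\<And>x y t. 0 \<le> t \<Longrightarrow> t \<le> 1 \<Longrightarrow> f (\<lambda>i. (1 - t) * x i + t * y i) \<le> (1 - t) * f x + t * f y"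
    and int: "\<And>x. (\<And>i. i < m \<Longrightarrow> x i \<in> \<int>) \<Longrightarrow> (\<And>i. i < m \<Longrightarrow> \<bar>x i\<bar> \<le> 1) \<Longrightarrow>
       (\<Sum>i<m. \<bar>x i\<bar>) \<le> real L \<Longrightarrow> f x \<le> B"
    and w: "\<And>i. i < m \<Longrightarrow> \<bar>w i\<bar> \<le> 1" "(\<Sum>i<m. \<bar>w i\<bar>) \<le> real L"
  shows "f w \<le> B"
  using w
proof (induction "card {i. i < m \<and> w i \<notin> \<int>}" arbitrary: w rule: less_induct)
  case (less w)
  define F where "F x = {i. i < m \<and> x i \<notin> \<int>}" for x :: "nat \<Rightarrow> real"
  have finF: "finite (F x)" for x by (simp add: F_def)
  have step: "f w \<le> B" if "0 \<le> t" "t \<le> 1" "w = (\<lambda>i. (1 - t) * x i + t * y i)" "f x \<le> B" "f y \<le> B" for t x y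
  proof -
    have "f w \<le> (1 - t) * f x + t * f y" using conv[OF that(1,2)] that(3) by simp
    also have "\<dots> \<le> (1 - t) * B + t * B" using that by (intro add_mono mult_left_mono) auto
    finally show ?thesis by (simp add: algebra_simps)
  qed
  have IH: "f x \<le> B" if "F x \<subset> F w" "\<And>i. i < m \<Longrightarrow> \<bar>x i\<bar> \<le> 1" "(\<Sum>i<m. \<bar>x i\<bar>) \<le> real L" for x
    using less.hyps[of x] psubset_card_mono[OF finF that(1)] that(2,3) by (simp add: F_def)
  have frac: "0 < \<bar>w i\<bar>" "\<bar>w i\<bar> < 1" "\<bar>sgn (w i)\<bar> = 1" "sgn (w i) * \<bar>w i\<bar> = w i" "sgn (w i) \<in> \<int>"
    if "i \<in> F w" for i
  proof -
    have i: "i < m" "w i \<notin> \<int>" using that by (auto simp: F_def)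
    then have "w i \<noteq> 0" "w i \<noteq> 1" "w i \<noteq> -1" by auto
    then show "0 < \<bar>w i\<bar>" "\<bar>w i\<bar> < 1" "\<bar>sgn (w i)\<bar> = 1" "sgn (w i) * \<bar>w i\<bar> = w i" "sgn (w i) \<in> \<int>"
      using less.prems(1)[OF i(1)] by (auto simp: sgn_if abs_if)
  qed
  show ?case
  proof (cases "F w = {}")
    case True
    then show ?thesis using less.prems by (intro int) (auto simp: F_def)
  next
    case False
    then obtain i where i: "i \<in> F w" by blast
    then have im: "i < m" by (simp add: F_def)
    have sum_i: "(\<Sum>k<m. \<bar>(x(i := c)) k\<bar>) = (\<Sum>k<m. \<bar>x k\<bar>) - \<bar>x i\<bar> + \<bar>c\<bar>" if "i < m" for x :: "nat \<Rightarrow> real" and c i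
      using that by (simp add: sum.remove[of "{..<m}" i])
    show ?thesis
    proof (cases "F w = {i}")
      case True
      have F_upd: "F (w(i := c)) \<subset> F w" if "c \<in> \<int>" for c using that i True by (auto simp: F_def)
      \<comment> \<open>With a single fractional coordinate the remaining mass is an integer below
        \<open>L\<close>, hence at most \<open>L - 1\<close>. So this coordinate may be replaced by
        its sign as well as by 0.\<close>
      have "(\<Sum>k\<in>{..<m} - {i}. \<bar>w k\<bar>) \<in> \<int>"
        using True by (intro Ints_sum Ints_abs) (auto simp: F_def)
      then obtain z where z: "(\<Sum>k<m. \<bar>w k\<bar>) - \<bar>w i\<bar> = real_of_int z"
        using im by (auto simp: sum.remove[of "{..<m}" i] elim!: Ints_cases)
      then have "real_of_int z < real_of_int (int L)" using less.prems(2) frac(1)[OF i] by simp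
      then have "z + 1 \<le> int L" by linarith
      then have z1: "real_of_int z + 1 \<le> real L" by linarith
      show ?thesis
      proof (rule step[of "\<bar>w i\<bar>" "w(i := 0)" "w(i := sgn (w i))"])
        show "w = (\<lambda>k. (1 - \<bar>w i\<bar>) * (w(i := 0)) k + \<bar>w i\<bar> * (w(i := sgn (w i))) k)"
          using frac(4)[OF i] by (auto simp: fun_eq_iff algebra_simps)
        show "f (w(i := 0)) \<le> B"
        proof (rule IH)
          show "(\<Sum>k<m. \<bar>(w(i := 0)) k\<bar>) \<le> real L" unfolding sum_i[OF im] using less.prems(2) by simp
        qed (use F_upd[of 0] less.prems(1) in auto)
        show "f (w(i := sgn (w i))) \<le> B"
        proof (rule IH)
          show "(\<Sum>k<m. \<bar>(w(i := sgn (w i))) k\<bar>) \<le> real L"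
            unfolding sum_i[OF im] using z z1 frac(3)[OF i] by simp
        qed (use F_upd[of "sgn (w i)"] less.prems(1) frac[OF i] in auto)
      qed (use frac[OF i] in auto)
    next
      case False
      then obtain j where j: "j \<in> F w" "j \<noteq> i" using i by blast
      then have jm: "j < m" by (simp add: F_def)
      define p q where "p = \<bar>w i\<bar>" and "q = \<bar>w j\<bar>"
      define \<sigma> \<tau> where "\<sigma> = sgn (w i)" and "\<tau> = sgn (w j)"
      have pq: "0 < p" "p < 1" "0 < q" "q < 1" "\<sigma> * p = w i" "\<tau> * q = w j" "\<bar>\<sigma>\<bar> = 1" "\<bar>\<tau>\<bar> = 1" "\<sigma> \<in> \<int>" "\<tau> \<in> \<int>"
        using frac[OF i] frac[OF j(1)] by (auto simp: p_def q_def \<sigma>_def \<tau>_def)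
      \<comment> \<open>Moves mass \<open>t\<close> from coordinate \<open>j\<close> to coordinate
        \<open>i\<close> with the signs kept; as long as both moduli stay in the unit interval, the
        total mass is unchanged.\<close>
      define v where "v t = w(i := \<sigma> * (p + t), j := \<tau> * (q - t))" for t
      have v_le: "f (v t) \<le> B" if t: "0 \<le> p + t" "p + t \<le> 1" "0 \<le> q - t" "q - t \<le> 1" "p + t \<in> \<int> \<or> q - t \<in> \<int>" for t
      proof (rule IH)
        have "F (v t) \<subseteq> F w" using i j by (auto simp: F_def v_def split: if_splits)
        moreover have "i \<notin> F (v t) \<or> j \<notin> F (v t)" using t(5) pq j(2) by (auto simp: F_def v_def)
        ultimately show "F (v t) \<subset> F w" using i j by blast
        show "\<bar>v t k\<bar> \<le> 1" if "k < m" for k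
          using less.prems(1)[OF that] t pq by (auto simp: v_def abs_mult)
        show "(\<Sum>k<m. \<bar>v t k\<bar>) \<le> real L"
          unfolding v_def sum_i[OF jm] sum_i[OF im]
          using less.prems(2) t pq j(2) by (simp add: abs_mult p_def[symmetric] q_def[symmetric])
      qed
      \<comment> \<open>The largest moves in the two directions: at \<open>a\<close> and at
        \<open>- b\<close> one of the two moduli reaches 0 or 1. The weight \<open>c\<close> puts
        \<open>w\<close> back on the segment between the end points.\<close>
      define a b where "a = min (1 - p) q" and "b = min p (1 - q)"
      have ab: "a > 0" "b > 0" "a \<le> 1 - p" "a \<le> q" "b \<le> p" "b \<le> 1 - q" using pq by (auto simp: a_def b_def)
      define c where "c = a / (a + b)"
      show ?thesis
      proof (rule step[of c "v a" "v (- b)"])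
        have "(1 - c) * a + c * (- b) = 0" using ab by (simp add: c_def field_simps)
        then have "w i = (1 - c) * (\<sigma> * (p + a)) + c * (\<sigma> * (p + - b))"
          "w j = (1 - c) * (\<tau> * (q - a)) + c * (\<tau> * (q - - b))"
          using pq(5,6) by algebra+
        then show "w = (\<lambda>k. (1 - c) * v a k + c * v (- b) k)"
          by (auto simp: fun_eq_iff v_def left_diff_distrib)
        show "f (v a) \<le> B"
          using ab pq by (intro v_le) (auto simp: a_def min_def)
        show "f (v (- b)) \<le> B"
          using ab pq by (intro v_le) (auto simp: b_def min_def)
      qed (use ab in \<open>auto simp: c_def\<close>)
    qed
  qed
qed

section \<open>The null space property\<close>

lemma l2norm_scaleR: "l2norm m (a *\<^sub>R x) = \<bar>a\<bar> * l2norm m x"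
proof -
  have "dotp m (a *\<^sub>R x) (a *\<^sub>R x) = a\<^sup>2 * dotp m x x" by (simp add: dotp_simps power2_eq_square)
  then show ?thesis by (simp only: l2norm_def real_sqrt_mult real_sqrt_abs)
qed

lemma l2norm_orth_residual:
  assumes "subspace Y" "Y \<subseteq> rvec m"
  shows "(l2norm m (x - orth_proj m Y x))\<^sup>2 = dotp m x x - dotp m (orth_proj m Y x) (orth_proj m Y x)"
  using dotp_orth_proj_self[OF assms, of x]
  by (simp add: l2norm_power2 dotp_simps dotp_commute[of m x "orth_proj m Y x"])

text \<open>The null space property for one support set. Keeping \<open>S\<close> fixed reduces its
  measurability for all small supports to a finite intersection.\<close>

definition sparse_null_space :: "nat \<Rightarrow> nat set \<Rightarrow> rseq set \<Rightarrow> bool" where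
  "sparse_null_space m S Y \<longleftrightarrow> (\<forall>u\<in>Y. u \<noteq> 0 \<longrightarrow>
     (\<Sum>i\<in>S. \<bar>Poly_Mapping.lookup u i\<bar>) < (\<Sum>i\<in>{..<m} - S. \<bar>Poly_Mapping.lookup u i\<bar>))"

lemma l1norm_eq_0_iff:
  assumes "u \<in> rvec m"
  shows "l1norm m u = 0 \<longleftrightarrow> u = 0"
proof
  assume "l1norm m u = 0"
  then have "Poly_Mapping.lookup u i = 0" if "i < m" for i
    using that by (simp add: l1norm_def sum_nonneg_eq_0_iff)
  then have "Poly_Mapping.lookup u i = 0" for i
    using lookup_rvec_eq_0[OF assms] by (cases "i < m") auto
  then show "u = 0" by (intro poly_mapping_eqI) simp
qed (simp add: l1norm_def)

text \<open>Scale a violating \<open>u \<in> Y\<close> to \<open>\<parallel>u\<parallel>\<^sub>1 = L\<close> and split it as \<open>k + w\<close>, where \<open>k\<close> rounds the coordinates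
  towards \<open>0\<close>. Half of the mass of \<open>u\<close> sits on \<open>S\<close>, so \<open>k\<close> has a large Euclidean norm, whereas
  the residuals of \<open>k\<close> and \<open>w\<close> modulo \<open>Y\<close> have equal length.\<close>

lemma sparse_null_space_of_integral_bounds:
  fixes \<rho> :: real
  assumes Y: "Y \<in> grassmannian m n" and r: "r > 0" and \<rho>: "\<rho> > 0"
    and lower: "\<And>k. k \<in> int_vectors m (1024 * r) \<Longrightarrow>
       \<rho> / 16 * dotp m k k \<le> dotp m k k - dotp m (orth_proj m Y k) (orth_proj m Y k)"
    and upper: "\<And>k. k \<in> int_vectors m (1024 * r) \<Longrightarrow>
       dotp m k k - dotp m (orth_proj m Y k) (orth_proj m Y k) \<le> 8 * \<rho> * dotp m k k"
    and S: "S \<subseteq> {..<m}" "card S \<le> r"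
  shows "sparse_null_space m S Y"
  unfolding sparse_null_space_def
proof (intro ballI impI, rule ccontr)
  note Y' = grassmannianD[OF Y]
  interpret P: linear "orth_proj m Y" by (rule linear_orth_proj[OF Y'(1,2)])
  define L where "L = 1024 * r"
  define h where "h x = l2norm m (x - orth_proj m Y x)" for x
  have h2: "(h x)\<^sup>2 = dotp m x x - dotp m (orth_proj m Y x) (orth_proj m Y x)" for x
    using l2norm_orth_residual[OF Y'(1,2)] by (simp add: h_def)
  have h_add: "h (x + y) \<le> h x + h y" for x y
    using l2norm_triangle[of m "x - orth_proj m Y x" "y - orth_proj m Y y"]
    by (simp add: h_def P.add algebra_simps)
  have h_scale: "h (a *\<^sub>R x) = \<bar>a\<bar> * h x" for a x
    by (simp add: h_def P.scale l2norm_scaleR scaleR_diff_right[symmetric])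
  have h_nonneg: "0 \<le> h x" for x by (simp add: h_def l2norm_nonneg)
  fix u assume u: "u \<in> Y" "u \<noteq> 0"
    "\<not> (\<Sum>i\<in>S. \<bar>Poly_Mapping.lookup u i\<bar>) < (\<Sum>i\<in>{..<m} - S. \<bar>Poly_Mapping.lookup u i\<bar>)"
  define a where "a = real L / l1norm m u"
  have l1u: "l1norm m u > 0"
  proof -
    have "l1norm m u \<noteq> 0" using l1norm_eq_0_iff[of u m] u Y' by blast
    moreover have "l1norm m u \<ge> 0" by (simp add: l1norm_def sum_nonneg)
    ultimately show ?thesis by linarith
  qed
  have a: "a > 0" using l1u r by (simp add: a_def L_def)
  define x where "x i = a * Poly_Mapping.lookup u i" for i
  define v where "v = a *\<^sub>R u"
  have "v \<in> Y" using u(1) Y'(1) by (simp add: v_def subspace_scale)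
  then have v: "v \<in> Y" "v \<in> rvec m" using Y'(2) by blast+
  have v_x: "v = vec_of m x"
  proof -
    have "x = Poly_Mapping.lookup v" by (simp add: fun_eq_iff x_def v_def)
    then show ?thesis using vec_of_lookup[OF v(2)] by simp
  qed
  have hv: "h v = 0" using orth_proj_id[OF Y'(1,2) v(1)] by (simp add: h_def l2norm_def dotp_simps)
  have sum_x: "(\<Sum>i<m. \<bar>x i\<bar>) = real L"
  proof -
    have "(\<Sum>i<m. \<bar>x i\<bar>) = a * l1norm m u"
      using a by (simp add: x_def abs_mult sum_distrib_left l1norm_def)
    then show ?thesis using l1u by (simp add: a_def)
  qed
  have "(\<Sum>i<m. \<bar>x i\<bar>) = (\<Sum>i\<in>S. \<bar>x i\<bar>) + (\<Sum>i\<in>{..<m} - S. \<bar>x i\<bar>)"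
    using S(1) by (subst sum.subset_diff[of S]) auto
  moreover have "(\<Sum>i\<in>{..<m} - S. \<bar>x i\<bar>) \<le> (\<Sum>i\<in>S. \<bar>x i\<bar>)"
    using u(3) a by (simp add: x_def abs_mult sum_distrib_left[symmetric])
  ultimately have sum_S: "(\<Sum>i\<in>S. \<bar>x i\<bar>) \<ge> 512 * real r" using sum_x by (simp add: L_def)
  \<comment> \<open>The integral part \<open>y\<close> and the fractional part \<open>z\<close> have
    the signs of \<open>x\<close> and are dominated by it entrywise, so both inherit the bound
    \<open>L\<close> on the sum of moduli.\<close>
  define y where "y i = sgn (x i) * real_of_int \<lfloor>\<bar>x i\<bar>\<rfloor>" for i
  define z where "z i = x i - y i" for i
  have y_abs: "\<bar>y i\<bar> = real_of_int \<lfloor>\<bar>x i\<bar>\<rfloor>" "\<bar>y i\<bar> \<le> \<bar>x i\<bar>" "\<bar>x i\<bar> - 1 \<le> \<bar>y i\<bar>" for i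
    by (auto simp: y_def abs_mult sgn_if)
  have y_int: "y i \<in> \<int>" for i by (simp add: y_def sgn_if)
  have "z i = sgn (x i) * frac \<bar>x i\<bar>" for i
    by (auto simp: z_def y_def frac_def sgn_if)
  then have z_abs: "\<bar>z i\<bar> = frac \<bar>x i\<bar>" for i by (auto simp: abs_mult sgn_if)
  have z_le: "\<bar>z i\<bar> \<le> 1" "\<bar>z i\<bar> \<le> \<bar>x i\<bar>" for i
    unfolding z_abs using frac_lt_1[of "\<bar>x i\<bar>"] by (auto simp: frac_def)
  have vec_add: "vec_of m (\<lambda>i. s * p i + t * q i) = s *\<^sub>R vec_of m p + t *\<^sub>R vec_of m q" for s t p q
    by (rule poly_mapping_eqI) (simp add: lookup_vec_of lookup_add)
  \<comment> \<open>The seminorm \<open>h\<close> is convex, so integral points with entries in {-1,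
    0, 1} suffice. For these the squared Euclidean length is at most the sum of moduli, hence at
    most \<open>L\<close>.\<close>
  have "h (vec_of m z) \<le> sqrt (8 * \<rho> * real L)"
  proof (rule convex_le_of_integral_le[where f = "\<lambda>w. h (vec_of m w)" and m = m and L = L])
    fix p q :: "nat \<Rightarrow> real" and t :: real assume t: "0 \<le> t" "t \<le> 1"
    show "h (vec_of m (\<lambda>i. (1 - t) * p i + t * q i)) \<le> (1 - t) * h (vec_of m p) + t * h (vec_of m q)"
      unfolding vec_add using h_add[of "(1 - t) *\<^sub>R vec_of m p" "t *\<^sub>R vec_of m q"] t
      by (simp add: h_scale)
  next
    fix w :: "nat \<Rightarrow> real"
    assume w: "\<And>i. i < m \<Longrightarrow> w i \<in> \<int>" "\<And>i. i < m \<Longrightarrow> \<bar>w i\<bar> \<le> 1" "(\<Sum>i<m. \<bar>w i\<bar>) \<le> real L"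
    have "vec_of m w \<in> int_vectors m L"
      using w by (simp add: int_vectors_def vec_of_in_rvec l1norm_def lookup_vec_of)
    then have "(h (vec_of m w))\<^sup>2 \<le> 8 * \<rho> * dotp m (vec_of m w) (vec_of m w)"
      unfolding h2 L_def by (rule upper)
    also have "\<dots> \<le> 8 * \<rho> * real L"
    proof -
      have "dotp m (vec_of m w) (vec_of m w) \<le> (\<Sum>i<m. \<bar>w i\<bar>)"
        unfolding dotp_vec_of_self
      proof (rule sum_mono)
        fix i assume "i \<in> {..<m}"
        then have "\<bar>w i\<bar> * \<bar>w i\<bar> \<le> \<bar>w i\<bar>" using w(2)[of i] by (intro mult_left_le) auto
        then show "(w i)\<^sup>2 \<le> \<bar>w i\<bar>" by (simp add: power2_eq_square abs_mult_self_eq)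
      qed
      then show ?thesis using w(3) \<rho> by simp
    qed
    finally show "h (vec_of m w) \<le> sqrt (8 * \<rho> * real L)" by (rule real_le_rsqrt)
  next
    show "(\<Sum>i<m. \<bar>z i\<bar>) \<le> real L" unfolding sum_x[symmetric] by (intro sum_mono z_le)
  qed (rule z_le)
  then have "(h (vec_of m z))\<^sup>2 \<le> 8 * \<rho> * real L"
    using h_nonneg \<rho> by (simp add: real_le_rsqrt sqrt_ge_absD)
  moreover have "h (vec_of m y) \<le> h (vec_of m z)"
  proof -
    have "vec_of m y = v + (-1) *\<^sub>R vec_of m z"
      unfolding v_x by (rule poly_mapping_eqI) (simp add: lookup_vec_of lookup_add lookup_minus z_def)
    then show ?thesis using h_add[of v "(-1) *\<^sub>R vec_of m z"] hv h_scale[of "-1"] by simp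
  qed
  moreover have "\<rho> / 16 * dotp m (vec_of m y) (vec_of m y) \<le> (h (vec_of m y))\<^sup>2"
  proof -
    have "(\<Sum>i<m. \<bar>y i\<bar>) \<le> real L" unfolding sum_x[symmetric] by (intro sum_mono y_abs)
    then have "vec_of m y \<in> int_vectors m L"
      using y_int by (simp add: int_vectors_def vec_of_in_rvec l1norm_def lookup_vec_of)
    then show ?thesis unfolding h2 L_def by (rule lower)
  qed
  \<comment> \<open>At least half of \<open>L\<close>, that is \<open>512 * r\<close>, sits on
    \<open>S\<close>, and rounding loses at most 1 on each of at most \<open>r\<close> coordinates.
    Cauchy-Schwarz on \<open>S\<close> converts the mass into Euclidean length.\<close>
  moreover have "511\<^sup>2 * real r \<le> dotp m (vec_of m y) (vec_of m y)"
  proof -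
    have "511 * real r \<le> (\<Sum>i\<in>S. \<bar>x i\<bar>) - real (card S)" using sum_S S(2) by simp
    also have "\<dots> = (\<Sum>i\<in>S. \<bar>x i\<bar> - 1)" by (simp add: sum_subtractf)
    also have "\<dots> \<le> (\<Sum>i\<in>S. \<bar>y i\<bar>)" by (intro sum_mono y_abs)
    finally have "(511 * real r)\<^sup>2 \<le> (\<Sum>i\<in>S. \<bar>y i\<bar>)\<^sup>2" by (intro power_mono) auto
    also have "\<dots> \<le> (\<Sum>i\<in>S. \<bar>y i\<bar>\<^sup>2) * real (card S)"
      by (rule sum_squared_le_sum_of_squares)
    also have "\<dots> \<le> dotp m (vec_of m y) (vec_of m y) * real r"
      unfolding dotp_vec_of_self using S
      by (intro mult_mono) (auto intro!: sum_mono2 sum_nonneg)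
    finally show ?thesis using r by (simp add: power2_eq_square)
  qed
  moreover have "(h (vec_of m y))\<^sup>2 \<le> (h (vec_of m z))\<^sup>2"
    using \<open>h (vec_of m y) \<le> h (vec_of m z)\<close> h_nonneg by (intro power_mono)
  moreover have "\<rho> / 16 * (511\<^sup>2 * real r) \<le> \<rho> / 16 * dotp m (vec_of m y) (vec_of m y)"
    using calculation(4) \<rho> by (intro mult_left_mono) auto
  ultimately have "\<rho> / 16 * (511\<^sup>2 * real r) \<le> 8 * \<rho> * real L" by linarith
  \<comment> \<open>The left constant exceeds 16000 while the right one is \<open>8 * 1024\<close>.
    The lower bound grows quadratically in \<open>L / r\<close> and the upper one linearly, so
    \<open>L = 1024 * r\<close> is large enough for a contradiction.\<close>
  then have "\<rho> * real r * (511\<^sup>2 / 16) \<le> \<rho> * real r * 8192" by (simp add: L_def algebra_simps)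
  moreover have "\<rho> * real r > 0" using \<rho> r by simp
  ultimately show False by simp
qed

text \<open>An equivalence, so that the recovery event coincides with a set whose measurability can
  be shown. A violating \<open>u\<close> ties with or beats 0 in approximating its own restriction
  to \<open>S\<close>; conversely the triangle inequality on the corrupted coordinates shows that
  every competitor is strictly worse.\<close>

lemma recovery_iff_sparse_null_space:
  assumes Y: "subspace Y" "Y \<subseteq> rvec m"
  shows "(\<forall>y\<in>Y. \<forall>y'\<in>rvec m.
            card {i. i < m \<and> Poly_Mapping.lookup y i \<noteq> Poly_Mapping.lookup y' i} \<le> r \<longrightarrow>
            (\<forall>v. is_arg_min (\<lambda>u. l1norm m (u - y')) (\<lambda>u. u \<in> Y) v \<longleftrightarrow> v = y))
     \<longleftrightarrow> (\<forall>S. S \<subseteq> {..<m} \<longrightarrow> card S \<le> r \<longrightarrow> sparse_null_space m S Y)" (is "?L \<longleftrightarrow> ?R")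
proof
  assume L: ?L
  show ?R unfolding sparse_null_space_def
  proof (intro allI impI ballI, rule ccontr)
    fix S u assume S: "S \<subseteq> {..<m}" "card S \<le> r" and u: "u \<in> Y" "u \<noteq> 0"
      "\<not> (\<Sum>i\<in>S. \<bar>Poly_Mapping.lookup u i\<bar>) < (\<Sum>i\<in>{..<m} - S. \<bar>Poly_Mapping.lookup u i\<bar>)"
    define y' where "y' = vec_of m (\<lambda>i. if i \<in> S then Poly_Mapping.lookup u i else 0)"
    have "{i. i < m \<and> Poly_Mapping.lookup 0 i \<noteq> Poly_Mapping.lookup y' i} \<subseteq> S"
      by (auto simp: y'_def lookup_vec_of split: if_splits)
    then have "card {i. i < m \<and> Poly_Mapping.lookup 0 i \<noteq> Poly_Mapping.lookup y' i} \<le> r"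
      using S finite_subset[OF S(1)] by (meson card_mono finite_lessThan le_trans)
    moreover have "y' \<in> rvec m" by (simp add: y'_def vec_of_in_rvec)
    ultimately have *: "is_arg_min (\<lambda>u. l1norm m (u - y')) (\<lambda>u. u \<in> Y) v \<longleftrightarrow> v = 0" for v
      using L subspace_0[OF Y(1)] by blast
    have split: "(\<Sum>i<m. g i) = (\<Sum>i\<in>S. g i) + (\<Sum>i\<in>{..<m} - S. g i)" for g :: "nat \<Rightarrow> real"
      using S(1) by (subst sum.subset_diff[of S]) auto
    have "l1norm m (u - y') = (\<Sum>i\<in>{..<m} - S. \<bar>Poly_Mapping.lookup u i\<bar>)"
      using S(1) unfolding l1norm_def split
      by (auto simp: lookup_minus y'_def lookup_vec_of intro!: sum.neutral sum.cong)
    also have "\<dots> \<le> (\<Sum>i\<in>S. \<bar>Poly_Mapping.lookup u i\<bar>)" using u(3) by simp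
    also have "\<dots> = l1norm m (0 - y')"
    proof -
      have "(\<Sum>i\<in>S. \<bar>Poly_Mapping.lookup (0 - y') i\<bar>) = (\<Sum>i\<in>S. \<bar>Poly_Mapping.lookup u i\<bar>)"
        using S(1) by (intro sum.cong) (auto simp: lookup_minus y'_def lookup_vec_of)
      moreover have "(\<Sum>i\<in>{..<m} - S. \<bar>Poly_Mapping.lookup (0 - y') i\<bar>) = 0"
        by (intro sum.neutral) (auto simp: lookup_minus y'_def lookup_vec_of)
      ultimately show ?thesis unfolding l1norm_def split by simp
    qed
    finally have "is_arg_min (\<lambda>u. l1norm m (u - y')) (\<lambda>u. u \<in> Y) u"
      using *[of 0] u(1) by (force simp: is_arg_min_def)
    then show False using * u(2) by simp
  qed
next
  assume R: ?R
  show ?L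
  proof (intro ballI impI allI)
    fix y y' v assume y: "y \<in> Y" "y' \<in> rvec m"
    assume card: "card {i. i < m \<and> Poly_Mapping.lookup y i \<noteq> Poly_Mapping.lookup y' i} \<le> r" (is "card ?S \<le> r")
    have "?S \<subseteq> {..<m}" by blast
    then have S: "sparse_null_space m ?S Y" using R card by blast
    have less: "l1norm m (y - y') < l1norm m (u - y')" if u: "u \<in> Y" "u \<noteq> y" for u
    proof -
      have split: "(\<Sum>i<m. g i) = (\<Sum>i\<in>?S. g i) + (\<Sum>i\<in>{..<m} - ?S. g i)" for g :: "nat \<Rightarrow> real"
        by (subst sum.subset_diff[of ?S]) auto
      have "u - y \<in> Y" "u - y \<noteq> 0" using u y Y by (auto simp: subspace_diff)
      then have "(\<Sum>i\<in>?S. \<bar>Poly_Mapping.lookup (u - y) i\<bar>) < (\<Sum>i\<in>{..<m} - ?S. \<bar>Poly_Mapping.lookup (u - y) i\<bar>)"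
        using S by (auto simp: sparse_null_space_def)
      \<comment> \<open>Off \<open>?S\<close> the vectors \<open>y\<close> and \<open>y'\<close>
        agree.\<close>
      also have "\<dots> = (\<Sum>i\<in>{..<m} - ?S. \<bar>Poly_Mapping.lookup (u - y') i\<bar>)"
        by (intro sum.cong) (auto simp: lookup_minus)
      finally have "(\<Sum>i\<in>?S. \<bar>Poly_Mapping.lookup (u - y) i\<bar>) + (\<Sum>i\<in>?S. \<bar>Poly_Mapping.lookup (u - y') i\<bar>)
          < l1norm m (u - y')" unfolding l1norm_def split by simp
      moreover have "(\<Sum>i\<in>?S. \<bar>Poly_Mapping.lookup (y - y') i\<bar>)
          \<le> (\<Sum>i\<in>?S. \<bar>Poly_Mapping.lookup (u - y) i\<bar> + \<bar>Poly_Mapping.lookup (u - y') i\<bar>)"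
        by (intro sum_mono) (simp add: lookup_minus)
      moreover have "l1norm m (y - y') = (\<Sum>i\<in>?S. \<bar>Poly_Mapping.lookup (y - y') i\<bar>)"
        unfolding l1norm_def split by (auto simp: lookup_minus intro!: sum.neutral)
      ultimately show ?thesis by (simp add: sum.distrib)
    qed
    show "is_arg_min (\<lambda>u. l1norm m (u - y')) (\<lambda>u. u \<in> Y) v \<longleftrightarrow> v = y"
      using less y by (auto simp: is_arg_min_def) (metis less_irrefl order_less_trans)+
  qed
qed

section \<open>Measurability and the union bound\<close>

definition split_norm :: "nat \<Rightarrow> nat set \<Rightarrow> rseq \<Rightarrow> real" where
  "split_norm m S u = (\<Sum>i\<in>{..<m} - S. \<bar>Poly_Mapping.lookup u i\<bar>) - (\<Sum>i\<in>S. \<bar>Poly_Mapping.lookup u i\<bar>)"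

lemma split_norm_scaleR: "split_norm m S (a *\<^sub>R u) = \<bar>a\<bar> * split_norm m S u"
  by (simp add: split_norm_def abs_mult sum_distrib_left[symmetric] algebra_simps)

text \<open>Stability under perturbation: the change is at most the sum of the moduli of the entries
  of \<open>u - p\<close>, and each entry is at most the Euclidean norm.\<close>

lemma split_norm_ge:
  assumes "S \<subseteq> {..<m}"
  shows "split_norm m S u \<ge> split_norm m S p - real m * l2norm m (u - p)"
proof -
  have split: "(\<Sum>i<m. g i) = (\<Sum>i\<in>S. g i) + (\<Sum>i\<in>{..<m} - S. g i)" for g :: "nat \<Rightarrow> real"
    using assms by (subst sum.subset_diff[of S]) auto
  have "(\<Sum>i\<in>S. \<bar>Poly_Mapping.lookup u i\<bar>)
      \<le> (\<Sum>i\<in>S. \<bar>Poly_Mapping.lookup p i\<bar> + \<bar>Poly_Mapping.lookup (u - p) i\<bar>)"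
    by (intro sum_mono) (simp add: lookup_minus)
  moreover have "(\<Sum>i\<in>{..<m} - S. \<bar>Poly_Mapping.lookup p i\<bar>)
      \<le> (\<Sum>i\<in>{..<m} - S. \<bar>Poly_Mapping.lookup u i\<bar> + \<bar>Poly_Mapping.lookup (u - p) i\<bar>)"
    by (intro sum_mono) (simp add: lookup_minus)
  moreover have "(\<Sum>i<m. \<bar>Poly_Mapping.lookup (u - p) i\<bar>) \<le> (\<Sum>i<m. l2norm m (u - p))"
    by (intro sum_mono abs_lookup_le_l2norm) simp
  then have "(\<Sum>i<m. \<bar>Poly_Mapping.lookup (u - p) i\<bar>) \<le> real m * l2norm m (u - p)" by simp
  ultimately show ?thesis
    unfolding split_norm_def split by (simp add: sum.distrib)
qed

text \<open>A continuous positive function has a positive minimum on the compact unit sphere of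
  \<open>Y\<close>; homogeneity extends the bound to all of \<open>Y\<close>.\<close>

lemma split_norm_coercive:
  assumes Y: "subspace Y" "Y \<subseteq> rvec m" and pos: "\<And>u. u \<in> Y \<Longrightarrow> u \<noteq> 0 \<Longrightarrow> 0 < split_norm m S u"
  obtains \<delta> where "\<delta> > 0" "\<And>u. u \<in> Y \<Longrightarrow> \<delta> * l2norm m u \<le> split_norm m S u"
proof -
  obtain E where E: "orthonormal m E" "span E = Y" using orthonormal_basis_exists[OF Y] by blast
  have fin: "finite E" using E(1) by (simp add: orthonormal_def)
  define comb where "comb c = (\<Sum>a\<in>E. c a *\<^sub>R a)" for c :: "rseq \<Rightarrow> real"
  \<comment> \<open>The unit sphere in coordinates with respect to \<open>E\<close>. Pinning
    coefficients outside \<open>E\<close> to 0 makes it a closed subset of a product of compact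
    sets.\<close>
  define K where "K = {c :: rseq \<Rightarrow> real. c \<in> PiE UNIV (\<lambda>a. if a \<in> E then {-1..1} else {0}) \<and> (\<Sum>a\<in>E. (c a)\<^sup>2) = 1}"
  have coord: "continuous_on UNIV (\<lambda>c :: rseq \<Rightarrow> real. c a)" for a
    by (rule continuous_on_product_coordinates)
  have compact: "compact K"
  proof -
    have "compactin (product_topology (\<lambda>_::rseq. euclidean :: real topology) UNIV) (PiE UNIV (\<lambda>a. if a \<in> E then {-1..1} else {0}))"
      unfolding compactin_PiE by auto
    then have "compact (PiE UNIV (\<lambda>a. if a \<in> E then {-1..1::real} else {0}))"
      by (simp add: euclidean_product_topology)
    moreover have "closed {c :: rseq \<Rightarrow> real. (\<Sum>a\<in>E. (c a)\<^sup>2) = 1}"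
      by (intro closed_Collect_eq continuous_on_sum continuous_on_power continuous_on_const coord)
    ultimately have "compact (PiE UNIV (\<lambda>a. if a \<in> E then {-1..1::real} else {0}) \<inter> {c. (\<Sum>a\<in>E. (c a)\<^sup>2) = 1})"
      by (rule compact_Int_closed)
    then show ?thesis by (simp add: K_def Collect_conj_eq)
  qed
  have cont: "continuous_on K (\<lambda>c. split_norm m S (comb c))"
  proof -
    have "Poly_Mapping.lookup (comb c) i = (\<Sum>a\<in>E. c a * Poly_Mapping.lookup a i)" for c i
      by (simp add: comb_def lookup_sum)
    then have "continuous_on UNIV (\<lambda>c. Poly_Mapping.lookup (comb c) i)" for i
      by (simp only:) (intro continuous_on_sum continuous_on_mult continuous_on_const coord)
    then have "continuous_on UNIV (\<lambda>c. split_norm m S (comb c))"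
      unfolding split_norm_def by (intro continuous_on_diff continuous_on_sum continuous_on_rabs)
    then show ?thesis by (rule continuous_on_subset) simp
  qed
  have unit: "\<exists>c\<in>K. u = l2norm m u *\<^sub>R comb c" if u: "u \<in> Y" "u \<noteq> 0" for u
  proof -
    define c where "c a = (if a \<in> E then dotp m u a / l2norm m u else 0)" for a
    have "dotp m u u > 0" using dotp_eq_0[of u m] dotp_nonneg[of m u] u Y(2) by (metis order_le_less subsetD)
    then have nz: "l2norm m u > 0" by (simp add: l2norm_def)
    have P: "orth_proj m (span E) u = u" unfolding E(2) by (rule orth_proj_id[OF Y u(1)])
    have "(\<Sum>a\<in>E. (c a)\<^sup>2) = (\<Sum>a\<in>E. (dotp m u a)\<^sup>2) / (l2norm m u)\<^sup>2"
      by (simp add: c_def power_divide sum_divide_distrib)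
    also have "(\<Sum>a\<in>E. (dotp m u a)\<^sup>2) = (l2norm m u)\<^sup>2"
      using dotp_orth_proj_orthonormal[OF E(1), of u] by (simp add: P l2norm_power2)
    also have "(l2norm m u)\<^sup>2 / (l2norm m u)\<^sup>2 = 1" using nz by simp
    finally have c1: "(\<Sum>a\<in>E. (c a)\<^sup>2) = 1" .
    have "\<bar>c a\<bar> \<le> 1" if "a \<in> E" for a
    proof -
      have "(c a)\<^sup>2 \<le> (\<Sum>a\<in>E. (c a)\<^sup>2)" using fin that by (intro member_le_sum) auto
      then show ?thesis by (simp add: c1 abs_square_le_1)
    qed
    then have "c a \<in> {-1..1}" if "a \<in> E" for a using that by (fastforce simp: abs_le_iff)
    moreover have "c a = 0" if "a \<notin> E" for a using that by (simp add: c_def)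
    ultimately have "c \<in> K" using c1 by (simp add: K_def PiE_iff)
    moreover have "u = l2norm m u *\<^sub>R comb c"
    proof -
      have "l2norm m u *\<^sub>R comb c = (\<Sum>a\<in>E. dotp m u a *\<^sub>R a)"
        using nz by (simp add: comb_def scaleR_sum_right c_def)
      then show ?thesis using orth_proj_orthonormal[OF E(1), of u] by (simp add: P)
    qed
    ultimately show ?thesis by blast
  qed
  show thesis
  proof (cases "K = {}")
    \<comment> \<open>Here every vector of \<open>Y\<close> is 0, so any positive constant will
      do.\<close>
    case True
    then have "u = 0" if "u \<in> Y" for u using unit[OF that] by blast
    then have "1 * l2norm m u \<le> split_norm m S u" if "u \<in> Y" for u
      using that by (fastforce simp: l2norm_def dotp_simps split_norm_def)
    then show thesis by (rule that[OF zero_less_one])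
  next
    case False
    then obtain c where c: "c \<in> K" "\<And>d. d \<in> K \<Longrightarrow> split_norm m S (comb c) \<le> split_norm m S (comb d)"
      using continuous_attains_inf[OF compact _ cont] by blast
    have "dotp m (comb c) (comb c) = 1"
      using c(1) by (simp add: comb_def orthonormal_dotp_self_combination[OF E(1)] K_def)
    then have "comb c \<noteq> 0" by (auto simp: dotp_simps)
    moreover have "comb c \<in> Y" unfolding comb_def E(2)[symmetric] by (intro span_sum span_scale span_base)
    ultimately have "split_norm m S (comb c) > 0" by (rule pos[rotated])
    moreover have "split_norm m S (comb c) * l2norm m u \<le> split_norm m S u" if u: "u \<in> Y" for u
    proof (cases "u = 0")
      case True
      then show ?thesis by (simp add: l2norm_def dotp_simps split_norm_def)
    next
      case False
      then obtain d where d: "d \<in> K" "u = l2norm m u *\<^sub>R comb d" using unit u by blast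
      have "split_norm m S u = l2norm m u * split_norm m S (comb d)"
        by (subst d(2)) (simp add: split_norm_scaleR l2norm_nonneg)
      then show ?thesis using c(2)[OF d(1)] l2norm_nonneg[of m u]
        by (simp add: mult.commute mult_left_mono)
    qed
    ultimately show thesis by (rule that)
  qed
qed

lemma gap_bound:
  assumes YZ: "Y \<in> grassmannian m n" "Z \<in> grassmannian m n" and u: "u \<in> rvec m"
  shows "l2norm m (orth_proj m Y u - orth_proj m Z u) \<le> gap m Y Z * l2norm m u"
proof (cases "u = 0")
  case True
  then show ?thesis using linear_0[OF linear_orth_proj] grassmannianD[OF YZ(1)] grassmannianD[OF YZ(2)]
    by (simp add: l2norm_def dotp_simps)
next
  case False
  have "dotp m u u > 0" using dotp_eq_0[OF u] dotp_nonneg[of m u] False by linarith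
  then have nz: "l2norm m u > 0" by (simp add: l2norm_def)
  define e where "e = (1 / l2norm m u) *\<^sub>R u"
  have "e \<in> rvec m" using u subspace_rvec by (simp add: e_def subspace_scale)
  moreover have "l2norm m e = 1" using nz by (simp add: e_def l2norm_scaleR)
  ultimately have "l2norm m (orth_proj m Y e - orth_proj m Z e) \<le> gap m Y Z"
    by (intro gap_upper[OF YZ]) auto
  moreover have "orth_proj m Y e - orth_proj m Z e = (1 / l2norm m u) *\<^sub>R (orth_proj m Y u - orth_proj m Z u)"
    using grassmannianD[OF YZ(1)] grassmannianD[OF YZ(2)]
    by (simp add: e_def orth_proj_scaleR scaleR_diff_right)
  ultimately show ?thesis using nz by (simp add: l2norm_scaleR divide_le_eq)
qed

text \<open>The set is open. For \<open>u\<close> in a nearby \<open>Z\<close> with projection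
  \<open>p\<close> onto \<open>Y\<close>, coercivity on \<open>Y\<close> and stability give
  \<open>split_norm m S u \<ge> \<delta> * l2norm m u - (\<delta> + real m) * l2norm m (u -
  p)\<close>, and the last norm is at most \<open>gap m Y Z * l2norm m u\<close>. Hence the radius
  \<open>\<delta> / (\<delta> + real m)\<close>.\<close>

lemma sparse_null_space_sets:
  assumes S: "S \<subseteq> {..<m}"
  shows "{Y \<in> grassmannian m n. sparse_null_space m S Y} \<in> sets (grassmannian_borel m n)"
proof (rule open_in_sets_grassmannian_borel)
  fix Y assume "Y \<in> {Y \<in> grassmannian m n. sparse_null_space m S Y}"
  then have Y: "Y \<in> grassmannian m n" and "\<And>u. u \<in> Y \<Longrightarrow> u \<noteq> 0 \<Longrightarrow> 0 < split_norm m S u"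
    by (auto simp: sparse_null_space_def split_norm_def)
  then obtain \<delta> where \<delta>: "\<delta> > 0" "\<And>u. u \<in> Y \<Longrightarrow> \<delta> * l2norm m u \<le> split_norm m S u"
    using split_norm_coercive[of Y m S] grassmannianD[OF Y] by metis
  have "sparse_null_space m S Z" if Z: "Z \<in> grassmannian m n" and gap: "gap m Y Z < \<delta> / (\<delta> + real m)" for Z
    unfolding sparse_null_space_def
  proof (intro ballI impI)
    fix u assume u: "u \<in> Z" "u \<noteq> 0"
    define p where "p = orth_proj m Y u"
    have ur: "u \<in> rvec m" using u(1) grassmannianD(2)[OF Z] by blast
    have "dotp m u u > 0" using dotp_eq_0[OF ur] dotp_nonneg[of m u] u(2) by linarith
    then have nz: "l2norm m u > 0" by (simp add: l2norm_def)
    have "orth_proj m Z u = u" using grassmannianD[OF Z] u(1) by (intro orth_proj_id)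
    then have up: "l2norm m (u - p) \<le> gap m Y Z * l2norm m u"
      using gap_bound[OF Y Z ur] by (simp add: p_def l2norm_minus_commute)
    have "(\<delta> + real m) * l2norm m (u - p) \<le> (\<delta> + real m) * (gap m Y Z * l2norm m u)"
      using up \<delta>(1) by (intro mult_left_mono) auto
    also have "\<dots> < \<delta> * l2norm m u"
    proof -
      have "gap m Y Z * (\<delta> + real m) < \<delta>" using gap \<delta>(1) by (simp add: pos_less_divide_eq)
      then show ?thesis using nz by (simp add: mult.assoc[symmetric] mult.commute[of _ "gap m Y Z"])
    qed
    finally have "(\<delta> + real m) * l2norm m (u - p) < \<delta> * l2norm m u" .
    moreover have "\<delta> * l2norm m u \<le> \<delta> * l2norm m p + \<delta> * l2norm m (u - p)"
      using l2norm_triangle[of m p "u - p"] \<delta>(1) by (simp add: distrib_left[symmetric])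
    moreover have "\<delta> * l2norm m p \<le> split_norm m S p"
      using orth_proj(1) grassmannianD[OF Y] by (intro \<delta>(2)) (simp add: p_def)
    moreover note split_norm_ge[OF S, of p u]
    ultimately have "0 < split_norm m S u" by (simp add: distrib_right)
    then show "(\<Sum>i\<in>S. \<bar>Poly_Mapping.lookup u i\<bar>) < (\<Sum>i\<in>{..<m} - S. \<bar>Poly_Mapping.lookup u i\<bar>)"
      by (simp add: split_norm_def)
  qed
  moreover have "\<delta> / (\<delta> + real m) > 0" using \<delta>(1) by simp
  ultimately show "\<exists>d>0. \<forall>Z\<in>grassmannian m n. gap m Y Z < d \<longrightarrow> Z \<in> {Y \<in> grassmannian m n. sparse_null_space m S Y}"
    by blast
qed blast

section \<open>The union bound over integer vectors and the conclusion\<close>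

lemma dotp_orth_proj_zero:
  assumes "Y \<in> grassmannian m n"
  shows "dotp m (orth_proj m Y 0) (orth_proj m Y 0) = 0"
  using dotp_orth_proj_self[of Y m 0] grassmannianD[OF assms] by (simp add: dotp_simps)

text \<open>With \<open>l = ln (real m / real r)\<close> the union bound costs
  \<open>exp (1029 * (real r * l))\<close>. The constant 8232 is \<open>8 * 1029\<close>, so this is
  at most \<open>exp (real R / 8)\<close>, half of the available exponent
  \<open>real R / 4\<close>.\<close>

lemma haar_sparse_null_space:
  assumes \<mu>: "is_haar_grassmannian m n \<mu>" and pos: "n > 0" "r > 0"
    and m: "m = n + R" and r: "real r < 1/8 * real m" and R: "real R \<ge> 8232 * real r * ln (real m / real r)"
  shows "measure \<mu> {Y \<in> grassmannian m n. \<forall>S. S \<subseteq> {..<m} \<longrightarrow> card S \<le> r \<longrightarrow> sparse_null_space m S Y}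
    \<ge> 1 - exp (- (1/8) * real R)"
proof -
  interpret prob_space \<mu> by (rule haar_grassmannianD(1)[OF \<mu>])
  define \<rho> where "\<rho> = real R / real m"
  define L where "L = 1024 * r"
  define l where "l = ln (real m / real r)"
  define q where "q = real r / real m"
  have m0: "real m > 0" using m pos by simp
  have r0: "real r > 0" using pos by simp
  \<comment> \<open>The sparsity bound makes the logarithm at least 1, so that terms of order
    \<open>real r\<close> and constant factors can be absorbed into
    \<open>real r * l\<close>.\<close>
  have "exp 1 \<le> real m / real r"
  proof -
    have "(3::real) \<le> real m / real r" using r r0 by (simp add: field_simps)
    then show ?thesis using exp_le by linarith
  qed
  then have l1: "1 \<le> l" unfolding l_def using m0 r0 by (simp add: ln_ge_iff)
  have rl: "1 \<le> real r * l" using mult_mono[of 1 "real r" 1 l] l1 pos by simp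
  have R0: "real R > 0" using R rl unfolding l_def[symmetric] by (simp add: mult.assoc)
  have \<rho>0: "\<rho> > 0" using R0 m0 by (simp add: \<rho>_def)
  have q: "0 < q" "q \<le> 1/2" using r m0 r0 by (simp_all add: q_def field_simps)
  \<comment> \<open>Concentration needs a nonzero vector; for 0 both integral bounds hold
    trivially.\<close>
  let ?N = "int_vectors m L - {0}"
  have finN: "finite ?N" using card_int_vectors(1)[OF q] by simp
  have "\<exists>B. B \<in> sets \<mu> \<and> measure \<mu> B \<le> 2 * exp (- real R / 4) \<and> (\<forall>Y\<in>grassmannian m n - B.
       \<rho> / 16 * dotp m k k \<le> dotp m k k - dotp m (orth_proj m Y k) (orth_proj m Y k) \<and>
       dotp m k k - dotp m (orth_proj m Y k) (orth_proj m Y k) \<le> 8 * \<rho> * dotp m k k)"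
    if k: "k \<in> ?N" for k
  proof -
    have "k \<in> rvec m" "k \<noteq> 0" using k by (auto simp: int_vectors_def)
    moreover have "\<rho> / 16 = real R / (16 * real m)" "8 * \<rho> = 8 * real R / real m" by (simp_all add: \<rho>_def)
    ultimately obtain B where "B \<in> sets \<mu>" "measure \<mu> B \<le> 2 * exp (- real R / 4)"
      "\<And>Y. Y \<in> grassmannian m n \<Longrightarrow> Y \<notin> B \<Longrightarrow>
        \<rho> / 16 * dotp m k k \<le> dotp m k k - dotp m (orth_proj m Y k) (orth_proj m Y k)"
      "\<And>Y. Y \<in> grassmannian m n \<Longrightarrow> Y \<notin> B \<Longrightarrow>
        dotp m k k - dotp m (orth_proj m Y k) (orth_proj m Y k) \<le> 8 * \<rho> * dotp m k k"
      using haar_concentration[OF \<mu> m pos(1)] by metis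
    then show ?thesis by blast
  qed
  then obtain B where B: "\<And>k. k \<in> ?N \<Longrightarrow> B k \<in> sets \<mu>" "\<And>k. k \<in> ?N \<Longrightarrow> measure \<mu> (B k) \<le> 2 * exp (- real R / 4)"
    "\<And>k Y. k \<in> ?N \<Longrightarrow> Y \<in> grassmannian m n - B k \<Longrightarrow>
       \<rho> / 16 * dotp m k k \<le> dotp m k k - dotp m (orth_proj m Y k) (orth_proj m Y k) \<and>
       dotp m k k - dotp m (orth_proj m Y k) (orth_proj m Y k) \<le> 8 * \<rho> * dotp m k k"
    by metis
  define H where "H = {Y \<in> grassmannian m n. \<forall>S. S \<subseteq> {..<m} \<longrightarrow> card S \<le> r \<longrightarrow> sparse_null_space m S Y}"
  have space: "space \<mu> = grassmannian m n" by (rule haar_grassmannianD(2)[OF \<mu>])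
  have HS: "H \<in> sets \<mu>"
  proof -
    have "H = space \<mu> \<inter> (\<Inter>S\<in>{S. S \<subseteq> {..<m} \<and> card S \<le> r}. {Y \<in> grassmannian m n. sparse_null_space m S Y})"
    proof -
      have "{} \<in> {S. S \<subseteq> {..<m} \<and> card S \<le> r}" by simp
      then show ?thesis unfolding H_def space by blast
    qed
    moreover have "(\<Inter>S\<in>{S. S \<subseteq> {..<m} \<and> card S \<le> r}. {Y \<in> grassmannian m n. sparse_null_space m S Y}) \<in> sets \<mu>"
    proof (rule sets.finite_INT)
      show "finite {S. S \<subseteq> {..<m} \<and> card S \<le> r}" by (rule finite_subset[of _ "Pow {..<m}"]) auto
      show "{S. S \<subseteq> {..<m} \<and> card S \<le> r} \<noteq> {}" by (auto intro!: exI[of _ "{}"])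
    qed (use sparse_null_space_sets haar_grassmannianD(3)[OF \<mu>] in auto)
    ultimately show ?thesis by simp
  qed
  have sub: "space \<mu> - H \<subseteq> (\<Union>k\<in>?N. B k)"
  proof
    fix Y assume "Y \<in> space \<mu> - H"
    then have Y: "Y \<in> grassmannian m n" "Y \<notin> H" by (auto simp: space)
    show "Y \<in> (\<Union>k\<in>?N. B k)"
    proof (rule ccontr)
      assume "Y \<notin> (\<Union>k\<in>?N. B k)"
      then have nB: "Y \<in> grassmannian m n - B k" if "k \<in> ?N" for k using that Y(1) by blast
      have bounds: "\<rho> / 16 * dotp m k k \<le> dotp m k k - dotp m (orth_proj m Y k) (orth_proj m Y k) \<and>
         dotp m k k - dotp m (orth_proj m Y k) (orth_proj m Y k) \<le> 8 * \<rho> * dotp m k k"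
        if "k \<in> int_vectors m L" for k
      proof (cases "k = 0")
        case True
        then show ?thesis using dotp_orth_proj_zero[OF Y(1)] by (simp add: dotp_simps)
      next
        case False
        then have "k \<in> ?N" using that by simp
        then show ?thesis using B(3) nB by blast
      qed
      have "Y \<in> H" unfolding H_def
        using sparse_null_space_of_integral_bounds[OF Y(1) pos(2) \<rho>0] bounds Y(1) by (simp add: L_def)
      then show False using Y(2) by blast
    qed
  qed
  have "measure \<mu> (space \<mu> - H) \<le> measure \<mu> (\<Union>k\<in>?N. B k)"
    using B(1) finN by (intro finite_measure_mono sub) auto
  also have "\<dots> \<le> (\<Sum>k\<in>?N. measure \<mu> (B k))"
    using B(1) finN by (intro finite_measure_subadditive_finite) auto
  also have "\<dots> \<le> real (card ?N) * (2 * exp (- real R / 4))"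
    using sum_bounded_above[of ?N "\<lambda>k. measure \<mu> (B k)"] B(2) by simp
  \<comment> \<open>The choice \<open>q = real r / real m\<close> makes the count at most
    \<open>exp (4 * real r)\<close> times \<open>exp (1024 * (real r * l))\<close>; the factor 2 is
    absorbed into \<open>exp (real r * l)\<close>.\<close>
  also have "\<dots> \<le> exp (1028 * (real r * l)) * (exp (real r * l) * exp (- real R / 4))"
  proof (intro mult_mono order_refl)
    have "real (card ?N) \<le> real (card (int_vectors m L))"
      using card_int_vectors(1)[OF q] by (intro of_nat_mono card_mono) auto
    also have "\<dots> \<le> (1 + 4 * q) ^ m / q ^ L" by (rule card_int_vectors(2)[OF q])
    also have "\<dots> \<le> exp (4 * real r) * exp (real L * l)"
    proof -
      have "(1 + 4 * q) ^ m \<le> exp (4 * q) ^ m" using q by (intro power_mono) auto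
      also have "\<dots> = exp (4 * real r)" using m0 by (simp add: exp_of_nat_mult[symmetric] q_def)
      finally have 1: "(1 + 4 * q) ^ m \<le> exp (4 * real r)" .
      have "exp l = 1 / q" using m0 r0 by (simp add: l_def q_def)
      then have "1 / q ^ L = exp (real L * l)" by (simp add: exp_of_nat_mult power_one_over)
      then have "(1 + 4 * q) ^ m / q ^ L = (1 + 4 * q) ^ m * exp (real L * l)"
        by (simp add: divide_inverse)
      then show ?thesis using 1 by simp
    qed
    also have "\<dots> \<le> exp (1028 * (real r * l))"
    proof -
      have "real r * 1 \<le> real r * l" using l1 by (intro mult_left_mono) auto
      then have "4 * real r + real L * l \<le> 1028 * (real r * l)" by (simp add: L_def algebra_simps)
      then show ?thesis by (simp add: mult_exp_exp)
    qed
    finally show "real (card ?N) \<le> exp (1028 * (real r * l))" .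
    have "(2::real) \<le> exp 1" using exp_ge_add_one_self[of "1::real"] by simp
    also have "\<dots> \<le> exp (real r * l)" using rl by simp
    finally show "2 \<le> exp (real r * l)" .
  qed auto
  also have "\<dots> = exp (1029 * (real r * l) - real R / 4)" by (simp add: mult_exp_exp)
  also have "\<dots> \<le> exp (- (1/8) * real R)" using R by (simp add: l_def)
  finally have "1 - measure \<mu> H \<le> exp (- (1/8) * real R)" using prob_compl[OF HS] by simp
  then show ?thesis by (simp add: H_def)
qed

theorem theorem1p1:
  shows "\<exists>C c :: real. C > 0 \<and> c > 0 \<and>
    (\<forall>m n r R :: nat. m > 0 \<longrightarrow> n > 0 \<longrightarrow> r > 0 \<longrightarrow> real r < c * real m \<longrightarrow> m = n + R \<longrightarrow>
      real R \<ge> C * real r * ln (real m / real r) \<longrightarrow>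
      (\<forall>\<mu>. is_haar_grassmannian m n \<mu> \<longrightarrow>
        \<P>(Y in \<mu>. \<forall>y\<in>Y. \<forall>y'\<in>rvec m.
            card {i. i < m \<and> Poly_Mapping.lookup y i \<noteq> Poly_Mapping.lookup y' i} \<le> r \<longrightarrow>
            (\<forall>v. is_arg_min (\<lambda>u. l1norm m (u - y')) (\<lambda>u. u \<in> Y) v \<longleftrightarrow> v = y))
          \<ge> 1 - exp (- c * real R)))"
proof (rule exI[of _ 8232], rule exI[of _ "1/8"], intro conjI allI impI)
  fix m n r R :: nat and \<mu>
  assume *: "m > 0" "n > 0" "r > 0" "real r < 1/8 * real m" "m = n + R"
    "real R \<ge> 8232 * real r * ln (real m / real r)" "is_haar_grassmannian m n \<mu>"
  let ?A = "{Y \<in> space \<mu>. \<forall>y\<in>Y. \<forall>y'\<in>rvec m.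
            card {i. i < m \<and> Poly_Mapping.lookup y i \<noteq> Poly_Mapping.lookup y' i} \<le> r \<longrightarrow>
            (\<forall>v. is_arg_min (\<lambda>u. l1norm m (u - y')) (\<lambda>u. u \<in> Y) v \<longleftrightarrow> v = y)}"
  \<comment> \<open>Equality of sets, not just inclusion, lets the estimate pass to the recovery
    event without a separate measurability argument.\<close>
  have "?A = {Y \<in> grassmannian m n. \<forall>S. S \<subseteq> {..<m} \<longrightarrow> card S \<le> r \<longrightarrow> sparse_null_space m S Y}"
    unfolding haar_grassmannianD(2)[OF *(7)]
    by (intro Collect_cong conj_cong refl recovery_iff_sparse_null_space grassmannianD)
  then show "measure \<mu> ?A \<ge> 1 - exp (- (1/8) * real R)"
    using haar_sparse_null_space[OF *(7,2,3,5,4,6)] by simp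
qed simp_all

end
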